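(* In the setting below, fix $0<\theta_l<\theta_u$, $\rho^0>0$, $\sigma>1$, $y^0\in\Upsilon_\tau$, and a tolerance $\epsilon>0$. Set $\epsilon_2=\dfrac{\epsilon}{2\sqrt2\,\theta_u}$ and $\epsilon_3=\epsilon$. Then there exists $\bar\epsilon_1>0$ such that for every $\epsilon_1\in(0,\bar\epsilon_1]$, Algorithm PDC terminates after finitely many iterations and the returned point $(y^*,v^* )$ is an $\epsilon$-approximate KKT stationary solution of the problem $$\min_{y,v}F(y,v)\quad\text{s.t. } y\in\Upsilon_\tau,\ v\in\mathcal V,\ \varphi(y,v)\le0.$$
   Context: Setting. $\mathcal A$ is a finite set of links; $\mathcal V=\{\Delta h: h\ge0,\ \Lambda h=d\}\subset\mathbb R^{|\mathcal A|}$, where $\Delta$ is a 0/1 link–route incidence matrix, $\Lambda$ a 0/1 OD–route incidence matrix in which every route belongs to exactly one OD pair and every OD pair has at least one route, and $d>0$ (so $\mathcal V$ is a nonempty compact convex polytope in $\mathbb R^{|\mathcal A|}_{\ge0}$). Let $u_a\ge0$, $\mathcal Y=\{y: 0\le y_a\le u_a\ \forall a\}$, $1\le\tau\le|\mathcal A|$, $\Upsilon_\tau=\{y\in\mathcal Y: |\{a: y_a>0\}|\le\tau\}$. Standing assumptions: each $t_a(y_a,v_a)$ is continuously differentiable and strictly increasing in $v_a$ for $y_a\ge0$; each $G_a$ is nonnegative, continuously differentiable, strictly increasing, convex; $\int_0^{v_a}t_a(y_a,w)dw$ and $t_a(y_a,v_a)v_a$ are convex in $(y_a,v_a)$. With $\eta>0$: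 $F(y,v)=\sum_a t_a(y_a,v_a)v_a+\eta\sum_aG_a(y_a)$, $f(y,v)=\sum_a\int_0^{v_a}t_a(y_a,w)dw$, $g(y)=\min_{v\in\mathcal V}f(y,v)$, $\varphi(y,v)=f(y,v)-g(y)$. $\mathcal V^*(y)$ is the set of $v\in\mathcal V$ with $\langle t(y,v),v'-v\rangle\ge0$ for all $v'\in\mathcal V$; it is a singleton equal to $\arg\min_{v\in\mathcal V}f(y,v)$. Known fact: $g$ is convex and continuously differentiable on $\mathcal Y$. Define $\Phi(y,v;\bar y,\bar v)=f(y,v)-g(\bar y)-\nabla g(\bar y)^{\mathsf T}(y-\bar y)$ and, for given $\rho^k,\beta^k>0$ and $(y^k,v^k)$, $\Psi^k(y,v)=F(y,v)+\rho^k\Phi(y,v;y^k,v^k)+\rho^k\beta^k\|(y-y^k,v-v^k)\|_2^2$. Algorithm AMA with inputs $(\rho^k,\beta^k,y^k,v^k;y^{k,0})$: for $j=0,1,\dots$: $v^{k,j+1}$ = unique minimizer of $\Psi^k(y^{k,j},\cdot)$ over $\mathcal V$; $y^{k,j+1}$ = a minimizer of $\Psi^k(\cdot,v^{k,j+1})$ over $\Upsilon_\tau$; stop if $(y^{k,j+1},v^{k,j+1})$ is partially optimal (i.e. $\Psi^k(y^{k,j+1},v^{k,j+1})\le\Psi^k(y^{k,j+1},v)\ \forall v\in\mathcal V$ and $\le\Psi^k(y,v^{k,j+1})\ \forall y\in\Upsilon_\tau$). $\mathrm{AMA}(\cdot)$ denotes the returned point if it stops, otherwise any accumulation point of its iterates.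 Algorithm PDC with parameters $\epsilon_1,\epsilon_2,\epsilon_3>0$, $0<\theta_l<\theta_u$, $\rho^0>0$, $\sigma>1$, $y^0\in\Upsilon_\tau$: set $v^0\in\mathcal V^*(y^0)$ and choose $\beta^0\in[\theta_l/\rho^0,\theta_u/\rho^0]$; for $k=0,1,\dots$: (i) $(y^{k+1},v^{k+1})=\mathrm{AMA}(\rho^k,\beta^k,y^k,v^k;y^k)$; (ii) if $\|y^{k+1}-y^k\|_2\le\epsilon_1$, $\|v^{k+1}-v^k\|_2\le\epsilon_2$ and $\Phi(y^{k+1},v^{k+1};y^k,v^k)\le\epsilon_3$, stop and return $(y^{k+1},v^{k+1})$; (iii) set $\rho^{k+1}=\sigma\rho^k$ if $\Phi(y^{k+1},v^{k+1};y^k,v^k)>\epsilon_3$, else $\rho^{k+1}=\rho^k$; (iv) choose $\beta^{k+1}\in[\theta_l/\rho^{k+1},\theta_u/\rho^{k+1}]$. For a closed set $X\subseteq\mathbb R^n$ and $\bar x\in X$, $\mathcal N_X(\bar x)$ is the limiting normal cone: $\bar z\in\mathcal N_X(\bar x)$ iff there exist $x^k\to\bar x$ with $x^k\in X$ and $z^k\to\bar z$ such that $\limsup_{x\to x^k,\,x\in X}\langle z^k,x-x^k\rangle/\|x-x^k\|_2\le0$ for all $k$ (for convex $X$ this is the usual normal cone). A point $(y^*,v^* )$ is an $\epsilon$-approximate KKT stationary solution of the displayed problem if $(y^*,v^* )\in\Upsilon_\tau\times\mathcal V$, $\varphi(y^*,v^* )\le\epsilon$, and there exists $\mu\ge0$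 with $$\operatorname{dist}\big(0,\ \nabla F(y^*,v^* )+\mu\nabla\varphi(y^*,v^* )+\mathcal N_{\Upsilon_\tau}(y^* )\times\mathcal N_{\mathcal V}(v^* )\big)\le\epsilon,$$ where gradients are taken with respect to $(y,v)$ and $\operatorname{dist}$ is Euclidean distance. *)

theory Defs
  imports "HOL-Analysis.Analysis"
begin

text \<open>Links are the finite type 'a, routes the finite type 'r, OD pairs the finite type 'w.
  Vectors indexed by links are elements of real^'a.  Delta a r is the link-route incidence
  matrix, Lambda w r the OD-route incidence matrix, d the demand vector.\<close>

definition Vset :: "('a::finite \<Rightarrow> 'r::finite \<Rightarrow> real) \<Rightarrow> ('w::finite \<Rightarrow> 'r \<Rightarrow> real)
    \<Rightarrow> ('w \<Rightarrow> real) \<Rightarrow> (real^'a) set" where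
  "Vset Delta Lambda d = {v. \<exists>h::real^'r. (\<forall>r. 0 \<le> h$r)
      \<and> (\<forall>w. (\<Sum>r\<in>UNIV. Lambda w r * h$r) = d w)
      \<and> (\<forall>a. v$a = (\<Sum>r\<in>UNIV. Delta a r * h$r))}"

definition Yset :: "('a::finite \<Rightarrow> real) \<Rightarrow> (real^'a) set" where
  "Yset u = {y. \<forall>a. 0 \<le> y$a \<and> y$a \<le> u a}"

definition Upsilon :: "('a::finite \<Rightarrow> real) \<Rightarrow> nat \<Rightarrow> (real^'a) set" where
  "Upsilon u tau = {y \<in> Yset u. card {a. 0 < y$a} \<le> tau}"

definition sint0 :: "(real \<Rightarrow> real) \<Rightarrow> real \<Rightarrow> real" where
  "sint0 h x = (if 0 \<le> x then integral {0..x} h else - integral {x..0} h)"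

definition tvec :: "('a::finite \<Rightarrow> real \<Rightarrow> real \<Rightarrow> real) \<Rightarrow> real^'a \<Rightarrow> real^'a \<Rightarrow> real^'a" where
  "tvec t y v = (\<chi> a. t a (y$a) (v$a))"

definition Fobj :: "('a::finite \<Rightarrow> real \<Rightarrow> real \<Rightarrow> real) \<Rightarrow> ('a \<Rightarrow> real \<Rightarrow> real) \<Rightarrow> real
    \<Rightarrow> real^'a \<Rightarrow> real^'a \<Rightarrow> real" where
  "Fobj t G eta y v = (\<Sum>a\<in>UNIV. t a (y$a) (v$a) * v$a) + eta * (\<Sum>a\<in>UNIV. G a (y$a))"

definition fpot :: "('a::finite \<Rightarrow> real \<Rightarrow> real \<Rightarrow> real) \<Rightarrow> real^'a \<Rightarrow> real^'a \<Rightarrow> real" where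
  "fpot t y v = (\<Sum>a\<in>UNIV. sint0 (t a (y$a)) (v$a))"

text \<open>g(y) = min over V of f(y,v) (written as an infimum; it is attained).\<close>
definition gval :: "(real^'a) set \<Rightarrow> (real^'a \<Rightarrow> real^'a \<Rightarrow> real) \<Rightarrow> real^'a \<Rightarrow> real" where
  "gval V f y = Inf ((\<lambda>v. f y v) ` V)"

definition grad :: "('b::real_inner \<Rightarrow> real) \<Rightarrow> 'b \<Rightarrow> 'b" where
  "grad h x = (SOME D. (h has_derivative (\<lambda>z. D \<bullet> z)) (at x))"

definition PhiL :: "(real^'a \<Rightarrow> real^'a \<Rightarrow> real) \<Rightarrow> (real^'a \<Rightarrow> real)
    \<Rightarrow> real^'a \<Rightarrow> real^'a \<Rightarrow> real^'a \<Rightarrow> real^'a \<Rightarrow> real" where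
  "PhiL f g y v yb vb = f y v - g yb - grad g yb \<bullet> (y - yb)"

definition Psi :: "(real^'a \<Rightarrow> real^'a \<Rightarrow> real) \<Rightarrow> (real^'a \<Rightarrow> real^'a \<Rightarrow> real) \<Rightarrow> (real^'a \<Rightarrow> real)
    \<Rightarrow> real \<Rightarrow> real \<Rightarrow> real^'a \<Rightarrow> real^'a \<Rightarrow> real^'a \<Rightarrow> real^'a \<Rightarrow> real" where
  "Psi F f g rho beta yk vk y v =
     F y v + rho * PhiL f g y v yk vk + rho * beta * (norm (y - yk, v - vk))\<^sup>2"

definition partial_opt :: "(real^'a \<Rightarrow> real^'a \<Rightarrow> real) \<Rightarrow> (real^'a) set \<Rightarrow> (real^'a) set
    \<Rightarrow> real^'a \<Rightarrow> real^'a \<Rightarrow> bool" where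
  "partial_opt P V U y v = ((\<forall>v'\<in>V. P y v \<le> P y v') \<and> (\<forall>y'\<in>U. P y v \<le> P y' v))"

text \<open>A run of AMA on objective P (= Psi^k) from y^{k,0} = y0: Y j = y^{k,j}, V j = v^{k,j}.
  Step j is performed as long as the method has not stopped at an earlier step.\<close>
definition ama_run :: "(real^'a \<Rightarrow> real^'a \<Rightarrow> real) \<Rightarrow> (real^'a) set \<Rightarrow> (real^'a) set
    \<Rightarrow> real^'a \<Rightarrow> (nat \<Rightarrow> real^'a) \<Rightarrow> (nat \<Rightarrow> real^'a) \<Rightarrow> bool" where
  "ama_run P V U y0 Y W =
    (Y 0 = y0 \<and>
     (\<forall>j. (\<forall>i<j. \<not> partial_opt P V U (Y (Suc i)) (W (Suc i))) \<longrightarrow>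
        (W (Suc j) \<in> V \<and> (\<forall>v'\<in>V. P (Y j) (W (Suc j)) \<le> P (Y j) v')
         \<and> Y (Suc j) \<in> U \<and> (\<forall>y'\<in>U. P (Y (Suc j)) (W (Suc j)) \<le> P y' (W (Suc j))))))"

definition ama_out :: "(real^'a \<Rightarrow> real^'a \<Rightarrow> real) \<Rightarrow> (real^'a) set \<Rightarrow> (real^'a) set
    \<Rightarrow> real^'a \<Rightarrow> (real^'a) \<times> (real^'a) \<Rightarrow> bool" where
  "ama_out P V U y0 p =
    (\<exists>Y W. ama_run P V U y0 Y W \<and>
      ((\<exists>j. partial_opt P V U (Y (Suc j)) (W (Suc j))
            \<and> (\<forall>i<j. \<not> partial_opt P V U (Y (Suc i)) (W (Suc i)))
            \<and> p = (Y (Suc j), W (Suc j)))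
       \<or> ((\<forall>j. \<not> partial_opt P V U (Y (Suc j)) (W (Suc j)))
            \<and> (\<exists>r. strict_mono r \<and> ((\<lambda>j. (Y (Suc (r j)), W (Suc (r j)))) \<longlonglongrightarrow> p)))))"

definition pdc_stop :: "(real^'a \<Rightarrow> real^'a \<Rightarrow> real) \<Rightarrow> (real^'a \<Rightarrow> real)
    \<Rightarrow> real \<Rightarrow> real \<Rightarrow> real \<Rightarrow> (nat \<Rightarrow> real^'a) \<Rightarrow> (nat \<Rightarrow> real^'a) \<Rightarrow> nat \<Rightarrow> bool" where
  "pdc_stop f g e1 e2 e3 ys vs k =
     (norm (ys (Suc k) - ys k) \<le> e1 \<and> norm (vs (Suc k) - vs k) \<le> e2
      \<and> PhiL f g (ys (Suc k)) (vs (Suc k)) (ys k) (vs k) \<le> e3)"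

text \<open>A run of PDC: ys k = y^k, vs k = v^k, rhos k = rho^k, betas k = beta^k.
  tv is the cost map t(y,v); the initial v^0 is in V*(y^0).\<close>
definition pdc_run :: "(real^'a \<Rightarrow> real^'a \<Rightarrow> real) \<Rightarrow> (real^'a \<Rightarrow> real^'a \<Rightarrow> real) \<Rightarrow> (real^'a \<Rightarrow> real)
    \<Rightarrow> (real^'a \<Rightarrow> real^'a \<Rightarrow> real^'a) \<Rightarrow> (real^'a) set \<Rightarrow> (real^'a) set
    \<Rightarrow> real \<Rightarrow> real \<Rightarrow> real \<Rightarrow> real \<Rightarrow> real \<Rightarrow> real \<Rightarrow> real \<Rightarrow> real^'a
    \<Rightarrow> (nat \<Rightarrow> real^'a) \<Rightarrow> (nat \<Rightarrow> real^'a) \<Rightarrow> (nat \<Rightarrow> real) \<Rightarrow> (nat \<Rightarrow> real) \<Rightarrow> bool" where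
  "pdc_run F f g tv V U e1 e2 e3 thl thu rho0 sig y0 ys vs rhos betas =
    (ys 0 = y0 \<and> vs 0 \<in> V \<and> (\<forall>v'\<in>V. 0 \<le> tv y0 (vs 0) \<bullet> (v' - vs 0))
     \<and> rhos 0 = rho0 \<and> thl / rhos 0 \<le> betas 0 \<and> betas 0 \<le> thu / rhos 0
     \<and> (\<forall>k. (\<forall>i<k. \<not> pdc_stop f g e1 e2 e3 ys vs i) \<longrightarrow>
           ama_out (Psi F f g (rhos k) (betas k) (ys k) (vs k)) V U (ys k) (ys (Suc k), vs (Suc k)))
     \<and> (\<forall>k. (\<forall>i\<le>k. \<not> pdc_stop f g e1 e2 e3 ys vs i) \<longrightarrow>
           (rhos (Suc k) = (if PhiL f g (ys (Suc k)) (vs (Suc k)) (ys k) (vs k) > e3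
                            then sig * rhos k else rhos k)
            \<and> thl / rhos (Suc k) \<le> betas (Suc k) \<and> betas (Suc k) \<le> thu / rhos (Suc k))))"

text \<open>Regular (Frechet) normals: limsup_{x->xb, x in X} <z, x - xb>/|x - xb| <= 0,
  written out with epsilon-delta.\<close>
definition regular_normal :: "'b::euclidean_space set \<Rightarrow> 'b \<Rightarrow> 'b set" where
  "regular_normal X xb = {z. \<forall>e>0. \<exists>d>0. \<forall>x\<in>X. 0 < dist x xb \<and> dist x xb < d
        \<longrightarrow> z \<bullet> (x - xb) \<le> e * norm (x - xb)}"

definition limiting_normal :: "'b::euclidean_space set \<Rightarrow> 'b \<Rightarrow> 'b set" where
  "limiting_normal X xb = {z. \<exists>xs zs. (\<forall>k. xs k \<in> X) \<and> xs \<longlonglongrightarrow> xb \<and> zs \<longlonglongrightarrow> z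
        \<and> (\<forall>k. zs k \<in> regular_normal X (xs k))}"

definition approx_kkt :: "(real^'a \<Rightarrow> real^'a \<Rightarrow> real) \<Rightarrow> (real^'a \<Rightarrow> real^'a \<Rightarrow> real)
    \<Rightarrow> (real^'a) set \<Rightarrow> (real^'a) set \<Rightarrow> real \<Rightarrow> real^'a \<Rightarrow> real^'a \<Rightarrow> bool" where
  "approx_kkt F phi U V eps y v =
    (y \<in> U \<and> v \<in> V \<and> phi y v \<le> eps \<and>
     (\<exists>mu\<ge>0. infdist 0
        {grad (\<lambda>p. F (fst p) (snd p)) (y, v) + mu *\<^sub>R grad (\<lambda>p. phi (fst p) (snd p)) (y, v) + (a, b)
          | a b. a \<in> limiting_normal U y \<and> b \<in> limiting_normal V v} \<le> eps))"

end

theory Submission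
  imports Defs
begin

text \<open>A point returned by AMA is partially optimal (for an accumulation point this follows from
  monotone descent alone), so the two first-order conditions give stationarity of \<open>\<Psi>\<^sup>k\<close>.
  Choosing the multiplier \<open>\<rho>\<^sup>k\<close>, the KKT residual is
  \<open>(\<rho>\<^sup>k (\<nabla>g(y\<^sup>k) - \<nabla>g(y\<^sup>*)) - 2 \<rho>\<^sup>k \<beta>\<^sup>k (y\<^sup>* - y\<^sup>k), - 2 \<rho>\<^sup>k \<beta>\<^sup>k (v\<^sup>* - v\<^sup>k))\<close>.
  Comparing \<open>\<Psi>\<^sup>k\<close> at the new iterate and at the lower-level solution for \<open>y\<^sup>k\<close> yields
  \<open>\<rho>\<^sup>k \<Phi> \<le> C\<close> with \<open>C\<close> independent of \<open>\<epsilon>\<^sub>1\<close>; hence the penalty is bounded uniformly, and uniform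
  continuity of \<open>\<nabla>g\<close> makes the residual small for small \<open>\<epsilon>\<^sub>1\<close>. Once the penalty is constant,
  convexity of \<open>g\<close> gives sufficient descent of \<open>F + \<rho> \<phi>\<close>, so the steps tend to zero and the
  method stops. The smoothness of \<open>g\<close> is Danskin's theorem, with the lower-level minimizer
  unique by strict monotonicity of the link costs.\<close>

subsection \<open>Gradients and normal cones\<close>

text \<open>\<open>grad\<close> is a choice, meaningful only once a representing vector exists.
  Riesz representation supplies one: the adjoint of the derivative evaluated at 1.\<close>

lemma has_derivative_grad:
  fixes h :: "'b::euclidean_space \<Rightarrow> real"
  assumes "h differentiable (at x)"
  shows "(h has_derivative (\<lambda>z. grad h x \<bullet> z)) (at x)"
proof -
  obtain h' where h': "(h has_derivative h') (at x)"
    using assms unfolding differentiable_def by blast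
  have "h' = (\<lambda>z. adjoint h' 1 \<bullet> z)"
    using adjoint_works[OF has_derivative_linear[OF h'], of _ "1::real"]
    by (auto simp: inner_commute)
  then have "\<exists>D. (h has_derivative (\<lambda>z. D \<bullet> z)) (at x)" using h' by metis
  then show ?thesis unfolding grad_def by (rule someI_ex)
qed

lemma grad_eqI:
  fixes h :: "'b::euclidean_space \<Rightarrow> real"
  assumes "(h has_derivative (\<lambda>z. D \<bullet> z)) (at x)"
  shows "grad h x = D"
proof -
  have "h differentiable (at x)" using assms unfolding differentiable_def by blast
  from has_derivative_unique[OF has_derivative_grad[OF this] assms]
  have "\<forall>z. grad h x \<bullet> z = D \<bullet> z" by metis
  then show ?thesis by (simp add: vector_eq_rdot)
qed

text \<open>Fermat's rule over an arbitrary, possibly nonconvex set: minimality makes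
  \<open>h y - h x\<close> nonnegative on \<open>X\<close>, so \<open>- D \<bullet> (y - x)\<close>
  is at most the first-order error. This covers the cardinality-constrained design set.\<close>

lemma minimizer_regular_normal:
  fixes h :: "'b::euclidean_space \<Rightarrow> real"
  assumes der: "(h has_derivative (\<lambda>z. D \<bullet> z)) (at x)"
    and min: "\<And>x'. x' \<in> X \<Longrightarrow> h x \<le> h x'"
  shows "- D \<in> regular_normal X x"
  unfolding regular_normal_def
proof (intro CollectI allI impI)
  fix e :: real assume "0 < e"
  with der obtain d where "0 < d"
    and d: "\<And>y. norm (y - x) < d \<Longrightarrow> norm (h y - h x - D \<bullet> (y - x)) \<le> e * norm (y - x)"
    unfolding has_derivative_at_alt by blast
  have "- D \<bullet> (y - x) \<le> e * norm (y - x)" if "y \<in> X" "dist y x < d" for y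
    using d[of y] min[OF that(1)] that(2) by (auto simp: dist_norm)
  with \<open>0 < d\<close> show "\<exists>d>0. \<forall>y\<in>X. 0 < dist y x \<and> dist y x < d \<longrightarrow> - D \<bullet> (y - x) \<le> e * norm (y - x)"
    by blast
qed

lemma regular_imp_limiting_normal:
  assumes "x \<in> X" "z \<in> regular_normal X x"
  shows "z \<in> limiting_normal X x"
  unfolding limiting_normal_def using assms
  by (intro CollectI exI[of _ "\<lambda>_. x"] exI[of _ "\<lambda>_. z"]) auto

lemma has_derivative_partial_fst:
  fixes h :: "'b::euclidean_space \<Rightarrow> 'c::euclidean_space \<Rightarrow> real"
  assumes "(\<lambda>p. h (fst p) (snd p)) differentiable (at (y, v))"
  shows "((\<lambda>y. h y v) has_derivative
    (\<lambda>z. fst (grad (\<lambda>p. h (fst p) (snd p)) (y, v)) \<bullet> z)) (at y)"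
proof -
  have "((\<lambda>y. (y, v)) has_derivative (\<lambda>z. (z, 0))) (at y)"
    by (auto intro!: derivative_eq_intros)
  from has_derivative_compose[OF this has_derivative_grad[OF assms]]
  show ?thesis by (simp add: inner_prod_def)
qed

lemma has_derivative_partial_snd:
  fixes h :: "'b::euclidean_space \<Rightarrow> 'c::euclidean_space \<Rightarrow> real"
  assumes "(\<lambda>p. h (fst p) (snd p)) differentiable (at (y, v))"
  shows "((\<lambda>v. h y v) has_derivative
    (\<lambda>z. snd (grad (\<lambda>p. h (fst p) (snd p)) (y, v)) \<bullet> z)) (at v)"
proof -
  have "((\<lambda>v. (y, v)) has_derivative (\<lambda>z. (0, z))) (at v)"
    by (auto intro!: derivative_eq_intros)
  from has_derivative_compose[OF this has_derivative_grad[OF assms]]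
  show ?thesis by (simp add: inner_prod_def)
qed

subsection \<open>The algorithms\<close>

lemma norm_Pair_sq: "(norm (x, y))\<^sup>2 = (norm x)\<^sup>2 + (norm y)\<^sup>2"
  by (simp add: norm_prod_def)

text \<open>Neither half-step increases \<open>P\<close>, so the limit value along a convergent
  subsequence lies below every value of the run, and both minimality properties pass to the limit by
  continuity. The last conclusion, which compares the output with the starting design under any
  flow, drives both the penalty bound and the descent estimate of the outer method.\<close>

lemma ama_out_partial_opt:
  fixes P :: "real^'a \<Rightarrow> real^'a \<Rightarrow> real"
  assumes "closed U" "closed V" "y0 \<in> U"
    and cont: "continuous_on (U \<times> V) (\<lambda>p. P (fst p) (snd p))"
    and out: "ama_out P V U y0 (y, v)"
  shows "y \<in> U" "v \<in> V" "partial_opt P V U y v" "\<And>v'. v' \<in> V \<Longrightarrow> P y v \<le> P y0 v'"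
proof -
  obtain Y W where run: "ama_run P V U y0 Y W"
    and cases: "(\<exists>j. partial_opt P V U (Y (Suc j)) (W (Suc j))
            \<and> (\<forall>i<j. \<not> partial_opt P V U (Y (Suc i)) (W (Suc i)))
            \<and> (y, v) = (Y (Suc j), W (Suc j)))
       \<or> ((\<forall>j. \<not> partial_opt P V U (Y (Suc j)) (W (Suc j)))
            \<and> (\<exists>r. strict_mono r \<and> ((\<lambda>j. (Y (Suc (r j)), W (Suc (r j)))) \<longlonglongrightarrow> (y, v))))"
    using out unfolding ama_out_def by blast
  \<comment> \<open>\<open>act j\<close> says that step \<open>j\<close> is really performed; the
    definition of a run constrains only such steps.\<close>
  define act where "act j \<longleftrightarrow> (\<forall>i<j. \<not> partial_opt P V U (Y (Suc i)) (W (Suc i)))" for j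
  have Y0: "Y 0 = y0" using run unfolding ama_run_def by blast
  have step: "W (Suc j) \<in> V" "\<And>v'. v' \<in> V \<Longrightarrow> P (Y j) (W (Suc j)) \<le> P (Y j) v'"
      "Y (Suc j) \<in> U" "\<And>y'. y' \<in> U \<Longrightarrow> P (Y (Suc j)) (W (Suc j)) \<le> P y' (W (Suc j))"
    if "act j" for j
    using run that unfolding ama_run_def act_def by blast+
  have actD: "act i" if "act j" "i \<le> j" for i j using that unfolding act_def by auto
  have YU: "Y j \<in> U" if "act j" for j
    using that Y0 \<open>y0 \<in> U\<close> step(3) actD by (cases j) (auto simp: act_def)
  \<comment> \<open>The flow step beats \<open>v'\<close> at \<open>Y j\<close>; the design step
    then beats \<open>Y j\<close>, which is itself feasible.\<close>
  have dec1: "P (Y (Suc j)) (W (Suc j)) \<le> P (Y j) v'" if "act j" "v' \<in> V" for j v'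
    using step(4)[OF that(1) YU[OF that(1)]] step(2)[OF that] by linarith
  \<comment> \<open>Only the first flow step is taken at \<open>y0\<close>, so the arbitrary
    competitor enters there; later steps compare with the current flow.\<close>
  have first: "P (Y (Suc j)) (W (Suc j)) \<le> P y0 v'" if "act j" "v' \<in> V" for j v'
    using that(1)
  proof (induction j)
    case 0
    then show ?case using dec1[OF 0 that(2)] Y0 by simp
  next
    case (Suc j)
    then have "act j" using actD by fastforce
    then show ?case using dec1[OF Suc.prems step(1)[OF \<open>act j\<close>]] Suc.IH by force
  qed
  have "y \<in> U \<and> v \<in> V \<and> partial_opt P V U y v \<and> (\<forall>v'\<in>V. P y v \<le> P y0 v')"
    using cases
  proof (elim disjE exE conjE)
    fix j assume "partial_opt P V U (Y (Suc j)) (W (Suc j))"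
      "\<forall>i<j. \<not> partial_opt P V U (Y (Suc i)) (W (Suc i))" "(y, v) = (Y (Suc j), W (Suc j))"
    then show ?thesis using step[of j] first[of j] unfolding act_def by auto
  next
    fix r :: "nat \<Rightarrow> nat"
    assume never: "\<forall>j. \<not> partial_opt P V U (Y (Suc j)) (W (Suc j))" and r: "strict_mono r"
      and lim: "(\<lambda>j. (Y (Suc (r j)), W (Suc (r j)))) \<longlonglongrightarrow> (y, v)"
    have act: "act j" for j using never unfolding act_def by blast
    have limY: "(\<lambda>j. Y (Suc (r j))) \<longlonglongrightarrow> y" using tendsto_fst[OF lim] by simp
    have limW: "(\<lambda>j. W (Suc (r j))) \<longlonglongrightarrow> v" using tendsto_snd[OF lim] by simp
    have yU: "y \<in> U"
      using closed_sequentially[OF \<open>closed U\<close> _ limY] step(3)[OF act] by blast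
    have vV: "v \<in> V"
      using closed_sequentially[OF \<open>closed V\<close> _ limW] step(1)[OF act] by blast
    have P_lim: "(\<lambda>j. P (a j) (b j)) \<longlonglongrightarrow> P a' b'"
      if "a \<longlonglongrightarrow> a'" "b \<longlonglongrightarrow> b'" "\<And>j. a j \<in> U" "\<And>j. b j \<in> V" "a' \<in> U" "b' \<in> V" for a b a' b'
      using continuous_on_tendsto_compose[OF cont tendsto_Pair[OF that(1,2)]] that(3-) by simp
    have L: "(\<lambda>j. P (Y (Suc (r j))) (W (Suc (r j)))) \<longlonglongrightarrow> P y v"
      by (rule P_lim[OF limY limW step(3)[OF act] step(1)[OF act] yU vV])
    have anti: "antimono (\<lambda>j. P (Y (Suc j)) (W (Suc j)))"
      using dec1[OF act step(1)[OF act]] by (intro decseq_SucI)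
    have low: "P y v \<le> P (Y (Suc j)) (W (Suc j))" for j
    proof (rule LIMSEQ_le_const2[OF L], intro exI allI impI)
      fix n assume "j \<le> n"
      then have "j \<le> r n" using seq_suble[OF r, of n] by simp
      then show "P (Y (Suc (r n))) (W (Suc (r n))) \<le> P (Y (Suc j)) (W (Suc j))"
        using antimonoD[OF anti] by blast
    qed
    \<comment> \<open>The flow optimal for \<open>Y (Suc (r n))\<close> has index
      \<open>Suc (Suc (r n))\<close>, possibly off the subsequence, so it may fail to converge along
      it. Its value is bounded below by \<open>P y v\<close> through \<open>low\<close>, and only
      \<open>Y (Suc (r n))\<close> is sent to the limit.\<close>
    have "P y v \<le> P y v'" if "v' \<in> V" for v'
    proof (rule LIMSEQ_le_const)
      show "(\<lambda>j. P (Y (Suc (r j))) v') \<longlonglongrightarrow> P y v'"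
        by (rule P_lim[OF limY tendsto_const step(3)[OF act] that yU that])
      show "\<exists>N. \<forall>n\<ge>N. P y v \<le> P (Y (Suc (r n))) v'"
        using low dec1[OF act that] order_trans by blast
    qed
    moreover have "P y v \<le> P y' v" if "y' \<in> U" for y'
    proof (rule LIMSEQ_le[OF L])
      show "(\<lambda>j. P y' (W (Suc (r j)))) \<longlonglongrightarrow> P y' v"
        by (rule P_lim[OF tendsto_const limW that step(1)[OF act] that vV])
      show "\<exists>N. \<forall>n\<ge>N. P (Y (Suc (r n))) (W (Suc (r n))) \<le> P y' (W (Suc (r n)))"
        using step(4)[OF act that] by blast
    qed
    moreover have "P y v \<le> P y0 v'" if "v' \<in> V" for v'
      using low[of 0] first[OF act that, of 0] by linarith
    ultimately show ?thesis using yU vV unfolding partial_opt_def by blast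
  qed
  then show "y \<in> U" "v \<in> V" "partial_opt P V U y v" "\<And>v'. v' \<in> V \<Longrightarrow> P y v \<le> P y0 v'"
    by blast+
qed

section \<open>The penalty method for an abstract bilevel problem\<close>

text \<open>Separates the convergence argument from the network: the lower level enters only as a
  smooth function \<open>g\<close> that lies above its tangents and is the attained minimum of
  \<open>f\<close> over \<open>V\<close>.\<close>

locale pdc_setting =
  fixes F f :: "real^'a::finite \<Rightarrow> real^'a \<Rightarrow> real" and g :: "real^'a \<Rightarrow> real"
    and V Y U :: "(real^'a) set"
  assumes compact_V: "compact V" and compact_Y: "compact Y"
    and closed_U: "closed U" and U_Y: "U \<subseteq> Y"
    and F_diff: "y \<in> Y \<Longrightarrow> v \<in> V \<Longrightarrow> (\<lambda>p. F (fst p) (snd p)) differentiable (at (y, v))"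
    and f_diff: "y \<in> Y \<Longrightarrow> v \<in> V \<Longrightarrow> (\<lambda>p. f (fst p) (snd p)) differentiable (at (y, v))"
    and g_diff: "y \<in> Y \<Longrightarrow> g differentiable (at y)"
    and grad_g_cont: "continuous_on Y (grad g)"
    and g_tangent: "y \<in> Y \<Longrightarrow> y' \<in> Y \<Longrightarrow> g y + grad g y \<bullet> (y' - y) \<le> g y'"
    and g_le: "y \<in> Y \<Longrightarrow> v \<in> V \<Longrightarrow> g y \<le> f y v"
    and g_attained: "y \<in> Y \<Longrightarrow> \<exists>v\<in>V. g y = f y v"
begin

text \<open>A tangent of the convex \<open>g\<close> underestimates it. Hence the stopping test on
  \<open>PhiL\<close> certifies the true lower-level gap, and a decrease in \<open>PhiL\<close>
  carries over to that gap.\<close>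

lemma phi_le_PhiL:
  assumes "y \<in> Y" "yb \<in> Y"
  shows "f y v - g y \<le> PhiL f g y v yb vb"
  using g_tangent[OF assms(2,1)] unfolding PhiL_def by simp

lemma continuous_on_F: "continuous_on (Y \<times> V) (\<lambda>p. F (fst p) (snd p))"
  by (auto intro!: continuous_at_imp_continuous_on differentiable_imp_continuous_within F_diff)

lemma continuous_on_f: "continuous_on (Y \<times> V) (\<lambda>p. f (fst p) (snd p))"
  by (auto intro!: continuous_at_imp_continuous_on differentiable_imp_continuous_within f_diff)

lemma continuous_on_Psi:
  "continuous_on (U \<times> V) (\<lambda>p. Psi F f g rho beta yk vk (fst p) (snd p))"
proof -
  have "U \<times> V \<subseteq> Y \<times> V" using U_Y by auto
  note [continuous_intros] = continuous_on_subset[OF continuous_on_F this]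
    continuous_on_subset[OF continuous_on_f this]
  show ?thesis unfolding Psi_def PhiL_def by (intro continuous_intros)
qed

text \<open>Partial optimality freezes one block at a time, so Fermat's rule applies to each partial
  gradient of \<open>Psi\<close>. The y-block contains the slope \<open>grad g yk\<close> of the
  linearization rather than \<open>grad g y\<close>; this mismatch reappears in the KKT
  residual.\<close>

lemma partial_opt_limiting_normal:
  fixes yk vk y v :: "real^'a" and rho beta :: real
  defines "GF \<equiv> grad (\<lambda>p. F (fst p) (snd p)) (y, v)"
    and "Gf \<equiv> grad (\<lambda>p. f (fst p) (snd p)) (y, v)"
  assumes yU: "y \<in> U" and vV: "v \<in> V"
    and opt: "partial_opt (Psi F f g rho beta yk vk) V U y v"
  shows "- (fst GF + rho *\<^sub>R (fst Gf - grad g yk) + (2 * (rho * beta)) *\<^sub>R (y - yk)) \<in> limiting_normal U y"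
    and "- (snd GF + rho *\<^sub>R snd Gf + (2 * (rho * beta)) *\<^sub>R (v - vk)) \<in> limiting_normal V v"
proof -
  have yY: "y \<in> Y" using yU U_Y by blast
  have sq: "((\<lambda>y. (norm (y - yk))\<^sup>2) has_derivative (\<lambda>z. (2 *\<^sub>R (y - yk)) \<bullet> z)) (at y)" for y yk :: "real^'a"
    unfolding power2_norm_eq_inner
    by (auto intro!: derivative_eq_intros simp: inner_commute)
  note Fy = has_derivative_partial_fst[OF F_diff[OF yY vV], folded GF_def]
  note fy = has_derivative_partial_fst[OF f_diff[OF yY vV], folded Gf_def]
  note Fv = has_derivative_partial_snd[OF F_diff[OF yY vV], folded GF_def]
  note fv = has_derivative_partial_snd[OF f_diff[OF yY vV], folded Gf_def]
  have "((\<lambda>y. Psi F f g rho beta yk vk y v) has_derivative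
     (\<lambda>z. (fst GF + rho *\<^sub>R (fst Gf - grad g yk) + (2 * (rho * beta)) *\<^sub>R (y - yk)) \<bullet> z)) (at y)"
    unfolding Psi_def PhiL_def norm_Pair_sq
    by (rule derivative_eq_intros Fy fy sq refl)+ (auto simp: algebra_simps inner_simps)
  then have "- (fst GF + rho *\<^sub>R (fst Gf - grad g yk) + (2 * (rho * beta)) *\<^sub>R (y - yk)) \<in> regular_normal U y"
    by (rule minimizer_regular_normal) (use opt in \<open>auto simp: partial_opt_def\<close>)
  then show "- (fst GF + rho *\<^sub>R (fst Gf - grad g yk) + (2 * (rho * beta)) *\<^sub>R (y - yk)) \<in> limiting_normal U y"
    using yU by (rule regular_imp_limiting_normal[rotated])
  have "((\<lambda>v. Psi F f g rho beta yk vk y v) has_derivative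
     (\<lambda>z. (snd GF + rho *\<^sub>R snd Gf + (2 * (rho * beta)) *\<^sub>R (v - vk)) \<bullet> z)) (at v)"
    unfolding Psi_def PhiL_def norm_Pair_sq
    by (rule derivative_eq_intros Fv fv sq refl)+ (auto simp: algebra_simps inner_simps)
  then have "- (snd GF + rho *\<^sub>R snd Gf + (2 * (rho * beta)) *\<^sub>R (v - vk)) \<in> regular_normal V v"
    by (rule minimizer_regular_normal) (use opt in \<open>auto simp: partial_opt_def\<close>)
  then show "- (snd GF + rho *\<^sub>R snd Gf + (2 * (rho * beta)) *\<^sub>R (v - vk)) \<in> limiting_normal V v"
    using vV by (rule regular_imp_limiting_normal[rotated])
qed

text \<open>With \<open>rho\<close> as multiplier, the normals from partial optimality cancel the
  gradients of \<open>F\<close> and \<open>f\<close>, leaving the gradient mismatch and the proximal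
  terms. A budget of \<open>eps / sqrt 2\<close> per block gives Euclidean norm at most
  \<open>eps\<close>.\<close>

lemma partial_opt_approx_kkt:
  assumes yU: "y \<in> U" and vV: "v \<in> V" and ykY: "yk \<in> Y"
    and opt: "partial_opt (Psi F f g rho beta yk vk) V U y v"
    and "0 \<le> rho" "0 \<le> eps"
    and Phi: "PhiL f g y v yk vk \<le> eps"
    and res_y: "rho * norm (grad g yk - grad g y) + 2 * \<bar>rho * beta\<bar> * norm (y - yk) \<le> eps / sqrt 2"
    and res_v: "2 * \<bar>rho * beta\<bar> * norm (v - vk) \<le> eps / sqrt 2"
  shows "approx_kkt F (\<lambda>y v. f y v - g y) U V eps y v"
proof -
  have yY: "y \<in> Y" using yU U_Y by blast
  define GF where "GF = grad (\<lambda>p. F (fst p) (snd p)) (y, v)"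
  define Gf where "Gf = grad (\<lambda>p. f (fst p) (snd p)) (y, v)"
  note N = partial_opt_limiting_normal[OF yU vV opt, folded GF_def Gf_def]
  define n1 where "n1 = - (fst GF + rho *\<^sub>R (fst Gf - grad g yk) + (2 * (rho * beta)) *\<^sub>R (y - yk))"
  define n2 where "n2 = - (snd GF + rho *\<^sub>R snd Gf + (2 * (rho * beta)) *\<^sub>R (v - vk))"
  have fd: "((\<lambda>p. f (fst p) (snd p)) has_derivative (\<lambda>z. Gf \<bullet> z)) (at (y, v))"
    unfolding Gf_def by (rule has_derivative_grad[OF f_diff[OF yY vV]])
  have gd: "((\<lambda>p. g (fst p)) has_derivative (\<lambda>z. grad g y \<bullet> fst z)) (at (y, v))"
    using has_derivative_compose[OF has_derivative_fst[OF has_derivative_ident], of g _ "(y, v)" UNIV]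
      has_derivative_grad[OF g_diff[OF yY]] by simp
  have "((\<lambda>p. f (fst p) (snd p) - g (fst p)) has_derivative (\<lambda>z. (Gf - (grad g y, 0)) \<bullet> z)) (at (y, v))"
    by (rule has_derivative_eq_rhs[OF has_derivative_diff[OF fd gd]])
      (auto simp: inner_diff_left inner_prod_def)
  then have Gphi: "grad (\<lambda>p. f (fst p) (snd p) - g (fst p)) (y, v) = Gf - (grad g y, 0)"
    by (rule grad_eqI)
  \<comment> \<open>The element of the shifted normal cone product whose norm bounds the distance
    from 0.\<close>
  define s where "s = GF + rho *\<^sub>R (Gf - (grad g y, 0)) + (n1, n2)"
  have s: "s = (rho *\<^sub>R (grad g yk - grad g y) - (2 * (rho * beta)) *\<^sub>R (y - yk),
      - ((2 * (rho * beta)) *\<^sub>R (v - vk)))"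
    unfolding s_def n1_def n2_def by (auto simp: prod_eq_iff algebra_simps)
  have "norm (fst s) \<le> eps / sqrt 2"
    unfolding s using norm_triangle_ineq4[of "rho *\<^sub>R (grad g yk - grad g y)" "(2 * (rho * beta)) *\<^sub>R (y - yk)"]
      res_y \<open>0 \<le> rho\<close> by (simp add: abs_mult)
  moreover have "norm (snd s) \<le> eps / sqrt 2"
    unfolding s using res_v by (simp add: abs_mult)
  ultimately have "(norm (fst s))\<^sup>2 + (norm (snd s))\<^sup>2 \<le> (eps / sqrt 2)\<^sup>2 + (eps / sqrt 2)\<^sup>2"
    by (intro add_mono power_mono) auto
  also have "\<dots> = eps\<^sup>2" by (simp add: power_divide)
  finally have "norm s \<le> eps"
    using \<open>0 \<le> eps\<close> by (metis norm_Pair_sq power2_le_imp_le prod.collapse)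
  moreover have "s \<in> {GF + rho *\<^sub>R (Gf - (grad g y, 0)) + (a, b)
          | a b. a \<in> limiting_normal U y \<and> b \<in> limiting_normal V v}"
    using N unfolding s_def n1_def n2_def by blast
  ultimately have "infdist 0 {GF + rho *\<^sub>R (Gf - (grad g y, 0)) + (a, b)
          | a b. a \<in> limiting_normal U y \<and> b \<in> limiting_normal V v} \<le> eps"
    using infdist_le[of s _ 0] by (metis (no_types, lifting) dist_0_norm order_trans)
  moreover have "f y v - g y \<le> eps" using phi_le_PhiL[OF yY ykY, of v vk] Phi by linarith
  ultimately show ?thesis
    unfolding approx_kkt_def Gphi GF_def using yU vV \<open>0 \<le> rho\<close> by blast
qed

lemma bounded_F: "\<exists>M. \<forall>y\<in>Y. \<forall>v\<in>V. \<bar>F y v\<bar> \<le> M"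
proof -
  have "bounded ((\<lambda>p. F (fst p) (snd p)) ` (Y \<times> V))"
    by (intro compact_imp_bounded compact_continuous_image continuous_on_F compact_Times compact_V compact_Y)
  then show ?thesis unfolding bounded_iff by auto
qed

section \<open>Bounded penalty, vanishing steps and termination\<close>

theorem pdc_terminates:
  assumes "0 < thl" "thl < thu" "0 < rho0" "1 < sig" "y0 \<in> U" "0 < eps"
  shows "\<exists>eb1>0. \<forall>e1. 0 < e1 \<and> e1 \<le> eb1 \<longrightarrow>
     (\<forall>ys vs rhos betas.
        pdc_run F f g tv V U e1 (eps / (2 * sqrt 2 * thu)) eps thl thu rho0 sig y0 ys vs rhos betas
        \<longrightarrow> (\<exists>K. pdc_stop f g e1 (eps / (2 * sqrt 2 * thu)) eps ys vs K
               \<and> (\<forall>i<K. \<not> pdc_stop f g e1 (eps / (2 * sqrt 2 * thu)) eps ys vs i)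
               \<and> approx_kkt F (\<lambda>y v. f y v - g y) U V eps (ys (Suc K)) (vs (Suc K))))"
proof -
  obtain M where M: "\<And>y v. y \<in> Y \<Longrightarrow> v \<in> V \<Longrightarrow> \<bar>F y v\<bar> \<le> M" using bounded_F by blast
  obtain N where N: "\<And>v. v \<in> V \<Longrightarrow> norm v \<le> N"
    using compact_imp_bounded[OF compact_V] unfolding bounded_iff by blast
  \<comment> \<open>\<open>2 * M\<close> bounds the difference of two values of \<open>F\<close>;
    the other term bounds the proximal cost of moving to a lower-level solution, with weight at most
    \<open>thu\<close> and distance at most \<open>2 * N\<close>.\<close>
  define C where "C = 2 * M + thu * (2 * N)\<^sup>2"
  \<comment> \<open>The penalty grows only if \<open>Phi k > eps\<close>; with
    \<open>rhos k * Phi k \<le> C\<close> this forces \<open>rhos k\<close> below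
    \<open>C / eps\<close>, and one update multiplies it by \<open>sig\<close>. \<open>R\<close>
    does not mention \<open>e1\<close>, so the threshold \<open>eb1\<close> can be chosen after
    it.\<close>
  define R where "R = max rho0 (sig * C / eps)"
  define e2 where "e2 = eps / (2 * sqrt 2 * thu)"
  have "0 < thu" "0 < R" using assms by (auto simp: R_def)
  have "0 < e2" using \<open>0 < thu\<close> assms unfolding e2_def by simp
  have "uniformly_continuous_on Y (grad g)"
    using compact_uniformly_continuous[OF grad_g_cont compact_Y] .
  then obtain del where "0 < del"
    and del: "\<And>y y'. y \<in> Y \<Longrightarrow> y' \<in> Y \<Longrightarrow> dist y' y < del \<Longrightarrow> dist (grad g y') (grad g y) < eps / (2 * sqrt 2 * R)"
    unfolding uniformly_continuous_on_def using assms(6) \<open>0 < R\<close>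
    by (metis divide_pos_pos mult_pos_pos real_sqrt_gt_zero zero_less_numeral)
  \<comment> \<open>The first entry keeps consecutive designs strictly within \<open>del\<close>,
    where the gradient mismatch times \<open>R\<close> is at most \<open>eps / (2 * sqrt 2)\<close>;
    the second bounds the y-part of the proximal term by the same amount.\<close>
  define eb1 where "eb1 = min (del / 2) (eps / (4 * sqrt 2 * thu))"
  have "0 < eb1" using \<open>0 < del\<close> \<open>0 < thu\<close> assms unfolding eb1_def by simp
  show ?thesis
  proof (intro exI[of _ eb1] conjI \<open>0 < eb1\<close> allI impI, elim conjE, fold e2_def)
    fix e1 ys vs rhos betas
    assume "0 < e1" and e1: "e1 \<le> eb1"
      and run: "pdc_run F f g tv V U e1 e2 eps thl thu rho0 sig y0 ys vs rhos betas"
    define stop where "stop = pdc_stop f g e1 e2 eps ys vs"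
    define Phi where "Phi k = PhiL f g (ys (Suc k)) (vs (Suc k)) (ys k) (vs k)" for k
    have init: "ys 0 = y0" "vs 0 \<in> V" "rhos 0 = rho0" "thl / rhos 0 \<le> betas 0" "betas 0 \<le> thu / rhos 0"
      using run unfolding pdc_run_def by blast+
    have ama: "ama_out (Psi F f g (rhos k) (betas k) (ys k) (vs k)) V U (ys k) (ys (Suc k), vs (Suc k))"
      if "\<forall>i<k. \<not> stop i" for k
      using run that unfolding pdc_run_def stop_def by blast
    have upd: "rhos (Suc k) = (if Phi k > eps then sig * rhos k else rhos k)"
      "thl / rhos (Suc k) \<le> betas (Suc k)" "betas (Suc k) \<le> thu / rhos (Suc k)"
      if "\<forall>i\<le>k. \<not> stop i" for k
      using run that unfolding pdc_run_def stop_def Phi_def by blast+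
    have step: "ys (Suc k) \<in> U" "vs (Suc k) \<in> V"
      "partial_opt (Psi F f g (rhos k) (betas k) (ys k) (vs k)) V U (ys (Suc k)) (vs (Suc k))"
      "\<And>v'. v' \<in> V \<Longrightarrow> Psi F f g (rhos k) (betas k) (ys k) (vs k) (ys (Suc k)) (vs (Suc k))
         \<le> Psi F f g (rhos k) (betas k) (ys k) (vs k) (ys k) v'"
      if "\<forall>i<k. \<not> stop i" "ys k \<in> U" for k
      using ama_out_partial_opt[OF closed_U compact_imp_closed[OF compact_V] that(2) continuous_on_Psi ama[OF that(1)]]
      by blast+
    have in_UV: "ys k \<in> U \<and> vs k \<in> V" if "\<forall>i<k. \<not> stop i" for k
      using that
    proof (induction k)
      case (Suc k)
      then show ?case using step[of k] by auto
    qed (use init assms in auto)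
    have inY: "ys k \<in> Y" if "\<forall>i<k. \<not> stop i" for k using in_UV[OF that] U_Y by blast
    \<comment> \<open>The choice of \<open>betas\<close> ties it to \<open>rhos\<close>, so the
      effective proximal weight stays in \<open>[thl, thu]\<close> however large the penalty
      becomes.\<close>
    have pen: "0 < rhos k \<and> thl \<le> rhos k * betas k \<and> rhos k * betas k \<le> thu"
      if "\<forall>i<k. \<not> stop i" for k
      using that
    proof (induction k)
      case 0
      then show ?case using init assms by (auto simp: field_simps)
    next
      case (Suc k)
      then have "0 < rhos k" by auto
      with upd(1)[of k] Suc.prems \<open>1 < sig\<close> have "0 < rhos (Suc k)" by auto
      with upd(2,3)[of k] Suc.prems show ?case by (auto simp: field_simps)
    qed
    \<comment> \<open>The competitor keeps the design \<open>ys k\<close> and takes a lower-level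
      solution \<open>v\<close> for it. There the linearized gap is zero, so the penalty drops out
      of the right-hand side.\<close>
    have Phi_bound: "rhos k * Phi k \<le> C" if k: "\<forall>i<k. \<not> stop i" for k
    proof -
      obtain v where v: "v \<in> V" "g (ys k) = f (ys k) v" using g_attained[OF inY[OF k]] by blast
      have kU: "ys k \<in> U" using in_UV[OF k] by blast
      have "F (ys (Suc k)) (vs (Suc k)) + rhos k * Phi k
          + rhos k * betas k * (norm (ys (Suc k) - ys k, vs (Suc k) - vs k))\<^sup>2
        \<le> F (ys k) v + rhos k * betas k * (norm (v - vs k))\<^sup>2"
        using step(4)[OF k kU v(1)] v(2) unfolding Psi_def PhiL_def Phi_def
        by (simp add: norm_Pair_sq)
      moreover have "0 \<le> rhos k * betas k * (norm (ys (Suc k) - ys k, vs (Suc k) - vs k))\<^sup>2"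
        using pen[OF k] assms by (intro mult_nonneg_nonneg[of "rhos k * betas k"]) auto
      moreover have "rhos k * betas k * (norm (v - vs k))\<^sup>2 \<le> thu * (2 * N)\<^sup>2"
      proof (rule mult_mono)
        have "norm (v - vs k) \<le> 2 * N"
          using norm_triangle_ineq4[of v "vs k"] N[OF v(1)] N[of "vs k"] in_UV[OF k] by linarith
        then show "(norm (v - vs k))\<^sup>2 \<le> (2 * N)\<^sup>2" by (rule power_mono) auto
      qed (use pen[OF k] \<open>0 < thu\<close> in auto)
      moreover have "ys (Suc k) \<in> Y" using step(1)[OF k kU] U_Y by blast
      then have "\<bar>F (ys (Suc k)) (vs (Suc k))\<bar> \<le> M" using M step(2)[OF k kU] by blast
      moreover have "\<bar>F (ys k) v\<bar> \<le> M" using M inY[OF k] v(1) by blast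
      ultimately show ?thesis unfolding C_def by linarith
    qed
    have rho_le: "rhos k \<le> R" if "\<forall>i<k. \<not> stop i" for k
      using that
    proof (induction k)
      case 0
      then show ?case using init by (simp add: R_def)
    next
      case (Suc k)
      show ?case
      proof (cases "Phi k > eps")
        case True
        have "rhos k * eps \<le> rhos k * Phi k" using pen[of k] Suc.prems True by simp
        also have "\<dots> \<le> C" using Phi_bound Suc.prems by auto
        finally have "sig * rhos k \<le> sig * C / eps"
          using \<open>0 < eps\<close> \<open>1 < sig\<close> by (simp add: field_simps)
        then show ?thesis using upd(1)[of k] Suc.prems True by (auto simp: R_def)
      next
        case False
        then show ?thesis using upd(1)[of k] Suc by auto
      qed
    qed
    have "\<exists>K. stop K"
    proof (rule ccontr)
      assume "\<nexists>K. stop K"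
      then have act: "\<forall>i<k. \<not> stop i" "\<forall>i\<le>k. \<not> stop i" for k by blast+
      have rho_mono: "rhos k \<le> rhos (Suc k)" for k
        using upd(1)[OF act(2), of k] pen[OF act(1), of k] \<open>1 < sig\<close> by auto
      then have "incseq rhos" by (rule incseq_SucI)
      then obtain L where L: "rhos \<longlonglongrightarrow> L" "\<And>k. rhos k \<le> L"
        using incseq_convergent[of rhos R] rho_le[OF act(1)] by blast
      have "0 < L" using L(2)[of 0] init assms by auto
      \<comment> \<open>Once \<open>rhos k\<close> exceeds \<open>L / sig\<close>, another
        multiplication by \<open>sig\<close> would overshoot the limit \<open>L\<close>; the penalty
        is therefore eventually constant.\<close>
      then have "L / sig < L" using \<open>1 < sig\<close> by (simp add: field_simps)
      then obtain k0 where k0: "\<And>k. k \<ge> k0 \<Longrightarrow> L / sig < rhos k"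
        using order_tendstoD(1)[OF L(1)] unfolding eventually_sequentially by blast
      have Phi_le: "Phi k \<le> eps" and rho_const: "rhos (Suc k) = rhos k" if "k \<ge> k0" for k
      proof -
        have "L < sig * rhos k" using k0[OF that] \<open>1 < sig\<close> by (simp add: field_simps)
        with L(2)[of "Suc k"] upd(1)[OF act(2), of k] show "Phi k \<le> eps" by (auto split: if_splits)
        then show "rhos (Suc k) = rhos k" using upd(1)[OF act(2), of k] by simp
      qed
      \<comment> \<open>The exact penalty function \<open>F + rho * phi\<close>, which serves as
        merit function once \<open>rho\<close> is frozen.\<close>
      define E where "E k = F (ys k) (vs k) + rhos k * (f (ys k) (vs k) - g (ys k))" for k
      define D where "D k = (norm (ys (Suc k) - ys k))\<^sup>2 + (norm (vs (Suc k) - vs k))\<^sup>2" for k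
      \<comment> \<open>The competitor \<open>(ys k, vs k)\<close> has zero proximal term and
        linearized gap equal to the true gap, so its \<open>Psi\<close> value is \<open>E k\<close>.
        At the new point the true gap is below the linearized one.\<close>
      have descent: "E (Suc k) + thl * D k \<le> E k" if "k \<ge> k0" for k
      proof -
        have "F (ys (Suc k)) (vs (Suc k)) + rhos k * Phi k + rhos k * betas k * D k \<le> E k"
          using step(4)[OF act(1), of k "vs k"] in_UV[OF act(1), of k]
          unfolding Psi_def PhiL_def Phi_def E_def D_def by (simp add: norm_Pair_sq)
        moreover have "thl * D k \<le> rhos k * betas k * D k"
          using pen[OF act(1), of k] by (intro mult_right_mono) (auto simp: D_def)
        moreover have "rhos k * (f (ys (Suc k)) (vs (Suc k)) - g (ys (Suc k))) \<le> rhos k * Phi k"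
          unfolding Phi_def using pen[OF act(1), of k]
          by (intro mult_left_mono phi_le_PhiL inY[OF act(1)]) auto
        ultimately show ?thesis unfolding E_def rho_const[OF that] by linarith
      qed
      have "- M \<le> E k" for k
      proof -
        have "0 \<le> rhos k * (f (ys k) (vs k) - g (ys k))"
          using pen[OF act(1), of k] g_le[OF inY[OF act(1), of k]] in_UV[OF act(1), of k]
          by (intro mult_nonneg_nonneg) auto
        then show ?thesis using M[OF inY[OF act(1), of k], of "vs k"] in_UV[OF act(1), of k]
          unfolding E_def by (auto simp: abs_le_iff)
      qed
      moreover have "decseq (\<lambda>k. E (k + k0))"
      proof (rule decseq_SucI)
        fix n
        have "0 \<le> thl * D (n + k0)" using \<open>0 < thl\<close> by (simp add: D_def)
        then show "E (Suc n + k0) \<le> E (n + k0)" using descent[of "n + k0"] by simp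
      qed
      ultimately obtain E0 where E0: "(\<lambda>k. E (k + k0)) \<longlonglongrightarrow> E0"
        using decseq_convergent[of "\<lambda>k. E (k + k0)" "- M"] by blast
      \<comment> \<open>A bounded decreasing merit sequence has vanishing decrements, and these
        dominate \<open>thl * D k\<close>; both step lengths eventually fall below the positive
        tolerances.\<close>
      have "(\<lambda>k. (E (k + k0) - E (Suc k + k0)) / thl) \<longlonglongrightarrow> (E0 - E0) / thl"
        using \<open>0 < thl\<close> by (intro tendsto_intros E0 LIMSEQ_Suc[OF E0]) auto
      then have "(\<lambda>k. (E (k + k0) - E (Suc k + k0)) / thl) \<longlonglongrightarrow> 0" by simp
      moreover define m where "m = min e1 e2"
      have "0 < m" using \<open>0 < e1\<close> \<open>0 < e2\<close> by (simp add: m_def)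
      ultimately obtain k where k: "(E (k + k0) - E (Suc k + k0)) / thl < m\<^sup>2"
        using order_tendstoD(2)[of _ 0 sequentially "m\<^sup>2"] unfolding eventually_sequentially
        by (meson order_refl zero_less_power)
      define n where "n = k + k0"
      have "thl * D n \<le> E n - E (Suc n)" using descent[of n] by (simp add: n_def)
      then have "D n \<le> (E n - E (Suc n)) / thl" using \<open>0 < thl\<close> by (simp add: field_simps)
      with k have "D n \<le> m\<^sup>2" by (simp add: n_def)
      then have "(norm (ys (Suc n) - ys n))\<^sup>2 \<le> m\<^sup>2" "(norm (vs (Suc n) - vs n))\<^sup>2 \<le> m\<^sup>2"
        unfolding D_def by (smt (verit) zero_le_power2)+
      then have "norm (ys (Suc n) - ys n) \<le> m" "norm (vs (Suc n) - vs n) \<le> m"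
        using \<open>0 < m\<close> by (auto intro: power2_le_imp_le)
      moreover have "Phi n \<le> eps" using Phi_le[of n] by (simp add: n_def)
      ultimately have "stop n" unfolding stop_def pdc_stop_def Phi_def m_def by simp
      with act show False by blast
    qed
    \<comment> \<open>The least stopping index is the actual one: all facts about the run presuppose
      that no earlier index stops.\<close>
    then obtain K where K: "stop K" "\<forall>i<K. \<not> stop i"
      using exists_least_iff[of stop] by blast
    have near: "norm (ys (Suc K) - ys K) \<le> e1" "norm (vs (Suc K) - vs K) \<le> e2" "Phi K \<le> eps"
      using K(1) unfolding stop_def pdc_stop_def Phi_def by auto
    have KU: "ys K \<in> U" and YK: "ys K \<in> Y" using in_UV[OF K(2)] U_Y by blast+
    note SK = step(1-3)[OF K(2) KU]
    have YSK: "ys (Suc K) \<in> Y" using SK(1) U_Y by blast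
    have rb: "0 < rhos K" "0 \<le> rhos K * betas K" "rhos K * betas K \<le> thu"
      using pen[OF K(2)] assms by auto
    \<comment> \<open>The y-budget is shared equally by the gradient mismatch and the proximal
      term.\<close>
    have s2: "eps / (2 * sqrt 2) + eps / (2 * sqrt 2) = eps / sqrt 2" by (simp add: field_simps)
    have "approx_kkt F (\<lambda>y v. f y v - g y) U V eps (ys (Suc K)) (vs (Suc K))"
    proof (rule partial_opt_approx_kkt[OF SK(1,2) YK SK(3)])
      have "dist (ys K) (ys (Suc K)) < del"
        using near(1) e1 \<open>0 < del\<close> by (simp add: dist_norm norm_minus_commute eb1_def)
      then have "norm (grad g (ys K) - grad g (ys (Suc K))) \<le> eps / (2 * sqrt 2 * R)"
        using del[OF YSK YK] by (simp add: dist_norm)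
      then have "rhos K * norm (grad g (ys K) - grad g (ys (Suc K))) \<le> R * (eps / (2 * sqrt 2 * R))"
        using rho_le[OF K(2)] rb(1) by (intro mult_mono) auto
      also have "\<dots> = eps / (2 * sqrt 2)" using \<open>0 < R\<close> by (simp add: field_simps)
      finally have a: "rhos K * norm (grad g (ys K) - grad g (ys (Suc K))) \<le> eps / (2 * sqrt 2)" .
      have "norm (ys (Suc K) - ys K) \<le> eps / (4 * sqrt 2 * thu)"
        using near(1) e1 by (simp add: eb1_def)
      then have "2 * \<bar>rhos K * betas K\<bar> * norm (ys (Suc K) - ys K) \<le> 2 * thu * (eps / (4 * sqrt 2 * thu))"
        using rb \<open>0 < thu\<close> by (intro mult_mono) auto
      also have "\<dots> = eps / (2 * sqrt 2)" using \<open>0 < thu\<close> by (simp add: field_simps)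
      finally show "rhos K * norm (grad g (ys K) - grad g (ys (Suc K)))
          + 2 * \<bar>rhos K * betas K\<bar> * norm (ys (Suc K) - ys K) \<le> eps / sqrt 2"
        using a s2 by linarith
      \<comment> \<open>The v-residual is purely proximal, which explains the value of
        \<open>e2\<close>: \<open>2 * thu * e2\<close> is exactly the v-budget.\<close>
      have "2 * \<bar>rhos K * betas K\<bar> * norm (vs (Suc K) - vs K) \<le> 2 * thu * e2"
        using rb \<open>0 < thu\<close> near(2) by (intro mult_mono) auto
      also have "\<dots> = eps / sqrt 2" using \<open>0 < thu\<close> by (simp add: e2_def field_simps)
      finally show "2 * \<bar>rhos K * betas K\<bar> * norm (vs (Suc K) - vs K) \<le> eps / sqrt 2" .
    qed (use near(3) rb assms in \<open>auto simp: Phi_def\<close>)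
    with K show "\<exists>K. pdc_stop f g e1 e2 eps ys vs K \<and> (\<forall>i<K. \<not> pdc_stop f g e1 e2 eps ys vs i)
        \<and> approx_kkt F (\<lambda>y v. f y v - g y) U V eps (ys (Suc K)) (vs (Suc K))"
      unfolding stop_def by blast
  qed
qed

end

subsection \<open>The value function of the lower level\<close>

lemma gval_eq:
  assumes "v \<in> V" "\<And>v'. v' \<in> V \<Longrightarrow> f y v \<le> f y v'"
  shows "gval V f y = f y v"
  unfolding gval_def by (rule cInf_eq_minimum) (use assms in auto)

text \<open>Flows at distance at least \<open>e\<close> from the unique minimizer \<open>v0\<close>
  form a compact set on which \<open>v0\<close> is strictly better at \<open>y0\<close>. By the tube
  lemma this strict inequality persists on one neighbourhood of \<open>y0\<close> for all these
  flows, so none of them minimizes there.\<close>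

lemma argmin_near:
  fixes f :: "'b::euclidean_space \<Rightarrow> 'c::euclidean_space \<Rightarrow> real"
  assumes "open \<Omega>" and sub: "{y0} \<times> V \<subseteq> \<Omega>" and "compact V"
    and cont: "continuous_on \<Omega> (\<lambda>p. f (fst p) (snd p))"
    and v0: "v0 \<in> V" and uniq: "\<And>v. v \<in> V \<Longrightarrow> v \<noteq> v0 \<Longrightarrow> f y0 v0 < f y0 v"
    and "0 < e"
  obtains X where "open X" "y0 \<in> X" "X \<times> V \<subseteq> \<Omega>"
    "\<forall>y\<in>X. \<forall>v\<in>V. (\<forall>v'\<in>V. f y v \<le> f y v') \<longrightarrow> dist v v0 < e"
proof -
  obtain X1 where X1: "y0 \<in> X1" "open X1" "X1 \<times> V \<subseteq> \<Omega>"
    using Elementary_Topology.tube_lemma[OF \<open>compact V\<close> \<open>open \<Omega>\<close> sub] by blast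
  \<comment> \<open>The comparison involves \<open>f\<close> at both \<open>(y, v)\<close> and
    \<open>(y, v0)\<close>, so both points must lie in the domain of continuity.\<close>
  define \<Omega>2 where "\<Omega>2 = \<Omega> \<inter> (\<lambda>p. (fst p, v0)) -` \<Omega>"
  have op2: "open \<Omega>2" unfolding \<Omega>2_def
    by (intro open_Int \<open>open \<Omega>\<close> open_vimage) (intro continuous_intros)
  have "continuous_on \<Omega>2 (\<lambda>p. f (fst p) (snd p))"
    by (rule continuous_on_subset[OF cont]) (auto simp: \<Omega>2_def)
  moreover have "continuous_on \<Omega>2 (\<lambda>p. (fst p, v0))" by (intro continuous_intros)
  then have "continuous_on \<Omega>2 (\<lambda>p. f (fst p) v0)"
    using continuous_on_compose2[OF cont, of \<Omega>2 "\<lambda>p. (fst p, v0)"] by (auto simp: \<Omega>2_def)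
  ultimately have "continuous_on \<Omega>2 (\<lambda>p. f (fst p) (snd p) - f (fst p) v0)"
    by (intro continuous_intros)
  then have open_gt: "open (\<Omega>2 \<inter> (\<lambda>p. f (fst p) (snd p) - f (fst p) v0) -` {0<..})"
    using continuous_open_preimage op2 open_greaterThan by blast
  have far: "compact (V - ball v0 e)" using \<open>compact V\<close> by (intro compact_diff) auto
  have "f y0 v0 < f y0 v" if "v \<in> V - ball v0 e" for v
    using uniq[of v] that \<open>0 < e\<close> by (cases "v = v0") auto
  then have sub_gt: "{y0} \<times> (V - ball v0 e) \<subseteq> \<Omega>2 \<inter> (\<lambda>p. f (fst p) (snd p) - f (fst p) v0) -` {0<..}"
    using sub v0 by (auto simp: \<Omega>2_def)
  obtain X2 where X2: "y0 \<in> X2" "open X2"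
    "X2 \<times> (V - ball v0 e) \<subseteq> \<Omega>2 \<inter> (\<lambda>p. f (fst p) (snd p) - f (fst p) v0) -` {0<..}"
    using Elementary_Topology.tube_lemma[OF far open_gt sub_gt] by blast
  have near: "dist v v0 < e" if "y \<in> X2" "v \<in> V" "\<forall>v'\<in>V. f y v \<le> f y v'" for y v
  proof (rule ccontr)
    assume "\<not> dist v v0 < e"
    then have "(y, v) \<in> X2 \<times> (V - ball v0 e)" using that by (auto simp: dist_commute)
    with X2(3) have "(y, v) \<in> (\<lambda>p. f (fst p) (snd p) - f (fst p) v0) -` {0<..}" by blast
    then have "f y v0 < f y v" by simp
    with that(3) v0 show False by force
  qed
  show ?thesis
  proof (rule that)
    show "open (X1 \<inter> X2)" "y0 \<in> X1 \<inter> X2" "(X1 \<inter> X2) \<times> V \<subseteq> \<Omega>" using X1 X2(1,2) by auto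
  qed (use near in blast)
qed

text \<open>Danskin's theorem by a sandwich: if \<open>v\<close> minimizes at \<open>y\<close>, the
  increment of the value function lies between \<open>f y v - f y0 v\<close> and
  \<open>f y v0 - f y0 v0\<close>. Both are close to the same linear term because \<open>v\<close>
  is close to \<open>v0\<close> by \<open>argmin_near\<close>.\<close>

lemma has_derivative_gval:
  fixes f :: "(real^'n) \<Rightarrow> (real^'n) \<Rightarrow> real"
  assumes "open \<Omega>" and sub: "{y0} \<times> V \<subseteq> \<Omega>" and "compact V"
    and der: "\<And>p. p \<in> \<Omega> \<Longrightarrow> ((\<lambda>p. f (fst p) (snd p)) has_derivative (\<lambda>z. D p \<bullet> z)) (at p)"
    and D_cont: "continuous_on \<Omega> D"
    and v0: "v0 \<in> V" and uniq: "\<And>v. v \<in> V \<Longrightarrow> v \<noteq> v0 \<Longrightarrow> f y0 v0 < f y0 v"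
  shows "(gval V f has_derivative (\<lambda>z. fst (D (y0, v0)) \<bullet> z)) (at y0)"
  unfolding has_derivative_at_alt
proof (intro conjI allI impI bounded_linear_inner_right)
  fix e :: real assume "0 < e"
  have cont: "continuous_on \<Omega> (\<lambda>p. f (fst p) (snd p))"
    using der by (intro continuous_at_imp_continuous_on) (auto intro: has_derivative_continuous)
  have min0: "f y0 v0 \<le> f y0 v" if "v \<in> V" for v
    using uniq[OF that] by (cases "v = v0") auto
  then have g0: "gval V f y0 = f y0 v0" using v0 by (intro gval_eq)
  have p0: "(y0, v0) \<in> \<Omega>" using sub v0 by auto
  from D_cont[unfolded continuous_on_iff, rule_format, OF p0 \<open>0 < e\<close>]
  obtain d1 where "0 < d1" and d1: "\<And>p. p \<in> \<Omega> \<Longrightarrow> dist p (y0, v0) < d1 \<Longrightarrow> dist (D p) (D (y0, v0)) < e"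
    by blast
  obtain X where X: "open X" "y0 \<in> X" "X \<times> V \<subseteq> \<Omega>"
    and near: "\<forall>y\<in>X. \<forall>v\<in>V. (\<forall>v'\<in>V. f y v \<le> f y v') \<longrightarrow> dist v v0 < d1 / 2"
    by (rule argmin_near[OF \<open>open \<Omega>\<close> sub \<open>compact V\<close> cont v0 uniq half_gt_zero[OF \<open>0 < d1\<close>]])
  obtain d2 where "0 < d2" and d2: "ball y0 d2 \<subseteq> X"
    by (rule openE[OF X(1,2)])
  \<comment> \<open>Half of \<open>d1\<close> is reserved for the distance in \<open>y\<close>, the
    other half for the distance in \<open>v\<close>.\<close>
  define d where "d = min d2 (d1 / 2)"
  have "0 < d" using \<open>0 < d1\<close> \<open>0 < d2\<close> by (simp add: d_def)
  \<comment> \<open>The mean value inequality is applied to \<open>f\<close> in its first argument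
    minus the target linear map, whose derivative stays below \<open>e\<close> by continuity of
    \<open>D\<close>; the estimate is uniform in \<open>v\<close> near \<open>v0\<close>.\<close>
  have key: "\<bar>f y v - f y0 v - fst (D (y0, v0)) \<bullet> (y - y0)\<bar> \<le> e * norm (y - y0)"
    if y: "y \<in> ball y0 d" and v: "v \<in> V" "dist v v0 < d1 / 2" for y v
  proof -
    have "norm ((f y v - fst (D (y0, v0)) \<bullet> y) - (f y0 v - fst (D (y0, v0)) \<bullet> y0)) \<le> e * norm (y - y0)"
    proof (rule differentiable_bound[of "ball y0 d"])
      fix x assume x: "x \<in> ball y0 d"
      then have xv: "(x, v) \<in> \<Omega>" using X(3) d2 v by (auto simp: d_def)
      have "((\<lambda>x. (x, v)) has_derivative (\<lambda>z. (z, 0))) (at x)"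
        by (auto intro!: derivative_eq_intros)
      from has_derivative_compose[OF this der[OF xv]]
      have "((\<lambda>x. f x v) has_derivative (\<lambda>z. D (x, v) \<bullet> (z, 0))) (at x)" by simp
      then show "((\<lambda>x. f x v - fst (D (y0, v0)) \<bullet> x) has_derivative
          (\<lambda>z. D (x, v) \<bullet> (z, 0) - fst (D (y0, v0)) \<bullet> z)) (at x within ball y0 d)"
        by (rule has_derivative_at_withinI[OF has_derivative_diff[OF _
              bounded_linear_imp_has_derivative[OF bounded_linear_inner_right]]])
      have "dist (x, v) (y0, v0) \<le> dist x y0 + dist v v0"
        using norm_Pair_le[of "x - y0" "v - v0"] by (simp add: dist_norm)
      also have "\<dots> < d1" using x v(2) by (auto simp: d_def dist_commute)
      finally have De: "norm (D (x, v) - D (y0, v0)) < e" using d1[OF xv] by (simp add: dist_norm)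
      show "onorm (\<lambda>z. D (x, v) \<bullet> (z, 0) - fst (D (y0, v0)) \<bullet> z) \<le> e"
      proof (rule onorm_le)
        fix z :: "real^'n"
        have "D (x, v) \<bullet> (z, 0) - fst (D (y0, v0)) \<bullet> z = (D (x, v) - D (y0, v0)) \<bullet> (z, 0)"
          by (simp add: inner_prod_def inner_diff_left)
        also have "\<bar>\<dots>\<bar> \<le> norm (D (x, v) - D (y0, v0)) * norm (z, 0 :: real^'n)"
          by (rule Cauchy_Schwarz_ineq2)
        also have "\<dots> \<le> e * norm z" using mult_right_mono[OF less_imp_le[OF De] norm_ge_zero[of z]] by (simp add: norm_Pair)
        finally show "norm (D (x, v) \<bullet> (z, 0) - fst (D (y0, v0)) \<bullet> z) \<le> e * norm z" by simp
      qed
    qed (use y \<open>0 < d\<close> in auto)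
    then show ?thesis by (simp add: inner_diff_right algebra_simps)
  qed
  have "norm (gval V f y - gval V f y0 - fst (D (y0, v0)) \<bullet> (y - y0)) \<le> e * norm (y - y0)"
    if "norm (y - y0) < d" for y
  proof -
    have yd: "y \<in> ball y0 d" using that by (simp add: dist_norm norm_minus_commute)
    then have yX: "y \<in> X" using d2 by (auto simp: d_def)
    have "continuous_on V (\<lambda>v. (y, v))" by (intro continuous_intros)
    then have "continuous_on V (f y)"
      using continuous_on_compose2[OF cont, of V "\<lambda>v. (y, v)"] yX X(3) by auto
    moreover have "V \<noteq> {}" using v0 by auto
    ultimately obtain v where v: "v \<in> V" "\<forall>v'\<in>V. f y v \<le> f y v'"
      using continuous_attains_inf[OF \<open>compact V\<close>, of "f y"] by blast
    have gy: "gval V f y = f y v" using v by (intro gval_eq) auto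
    have "f y v \<le> f y v0" using v v0 by blast
    moreover have "dist v v0 < d1 / 2" using near yX v by blast
    note key[OF yd v(1) this]
    moreover have "\<bar>f y v0 - f y0 v0 - fst (D (y0, v0)) \<bullet> (y - y0)\<bar> \<le> e * norm (y - y0)"
      using key[OF yd v0] \<open>0 < d1\<close> by simp
    ultimately show ?thesis
      using min0[OF v(1)] unfolding gy g0 real_norm_def abs_le_iff by linarith
  qed
  with \<open>0 < d\<close> show "\<exists>d>0. \<forall>y. norm (y - y0) < d \<longrightarrow>
      norm (gval V f y - gval V f y0 - fst (D (y0, v0)) \<bullet> (y - y0)) \<le> e * norm (y - y0)" by blast
qed

text \<open>Danskin's gradient is evaluated at the pair of \<open>y\<close> and its minimizer, so
  continuity of the minimizer is what makes \<open>g\<close> continuously differentiable.\<close>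

lemma continuous_on_argmin:
  fixes f :: "'b::euclidean_space \<Rightarrow> 'c::euclidean_space \<Rightarrow> real"
  assumes "open \<Omega>" and sub: "Y \<times> V \<subseteq> \<Omega>" and "compact V"
    and cont: "continuous_on \<Omega> (\<lambda>p. f (fst p) (snd p))"
    and m: "\<And>y. y \<in> Y \<Longrightarrow> m y \<in> V"
    and uniq: "\<And>y v. y \<in> Y \<Longrightarrow> v \<in> V \<Longrightarrow> v \<noteq> m y \<Longrightarrow> f y (m y) < f y v"
  shows "continuous_on Y m"
  unfolding continuous_on_iff
proof (intro ballI allI impI)
  fix y e assume "y \<in> Y" "0 < (e::real)"
  then have sub_y: "{y} \<times> V \<subseteq> \<Omega>" using sub by auto
  obtain X where X: "open X" "y \<in> X"
    and near: "\<forall>x\<in>X. \<forall>v\<in>V. (\<forall>v'\<in>V. f x v \<le> f x v') \<longrightarrow> dist v (m y) < e"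
    by (rule argmin_near[OF \<open>open \<Omega>\<close> sub_y \<open>compact V\<close> cont m[OF \<open>y \<in> Y\<close>] uniq[OF \<open>y \<in> Y\<close>] \<open>0 < e\<close>])
  obtain d where "0 < d" "ball y d \<subseteq> X" using X open_contains_ball by blast
  moreover have "dist (m x) (m y) < e" if "x \<in> Y" "x \<in> X" for x
  proof -
    have "f x (m x) \<le> f x v" if "v \<in> V" for v
      using uniq[OF \<open>x \<in> Y\<close> that] by (cases "v = m x") auto
    then show ?thesis using near \<open>x \<in> X\<close> m[OF \<open>x \<in> Y\<close>] by blast
  qed
  ultimately show "\<exists>d>0. \<forall>x\<in>Y. dist x y < d \<longrightarrow> dist (m x) (m y) < e"
    by (intro exI[of _ d]) (auto simp: dist_commute subset_iff)
qed

text \<open>Partial minimization preserves joint convexity: the convex combination of two minimizers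
  is a feasible competitor at the combined point.\<close>

lemma convex_on_gval:
  fixes f :: "real^'n \<Rightarrow> real^'n \<Rightarrow> real"
  assumes conv: "convex_on (Y \<times> V) (\<lambda>p. f (fst p) (snd p))" and "convex Y" "convex V"
    and m: "\<And>y. y \<in> Y \<Longrightarrow> m y \<in> V"
    and min: "\<And>y v. y \<in> Y \<Longrightarrow> v \<in> V \<Longrightarrow> f y (m y) \<le> f y v"
  shows "convex_on Y (gval V f)"
proof (rule convex_onI[OF _ \<open>convex Y\<close>])
  fix s :: real and x y assume s: "0 < s" "s < 1" and xy: "x \<in> Y" "y \<in> Y"
  have g: "gval V f z = f z (m z)" if "z \<in> Y" for z using m min that by (intro gval_eq) auto
  define z where "z = (1 - s) *\<^sub>R x + s *\<^sub>R y"
  have z: "z \<in> Y" using xy s \<open>convex Y\<close> unfolding z_def by (intro convexD) auto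
  have w: "(1 - s) *\<^sub>R m x + s *\<^sub>R m y \<in> V"
    using m xy s \<open>convex V\<close> by (intro convexD) auto
  have "gval V f z \<le> f z ((1 - s) *\<^sub>R m x + s *\<^sub>R m y)" using g[OF z] min[OF z w] by simp
  also have "\<dots> \<le> (1 - s) * f x (m x) + s * f y (m y)"
    using convex_onD[OF conv, of s "(x, m x)" "(y, m y)"] xy m s by (simp add: z_def)
  finally show "gval V f ((1 - s) *\<^sub>R x + s *\<^sub>R y) \<le> (1 - s) * gval V f x + s * gval V f y"
    using g xy by (simp add: z_def)
qed

text \<open>Along the segment towards \<open>y'\<close> the difference quotients are bounded by the
  chord slope. The limit is one-sided because \<open>y\<close> may lie on the boundary of
  \<open>Y\<close>.\<close>

lemma convex_on_above_tangent:
  fixes g :: "'b::euclidean_space \<Rightarrow> real"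
  assumes conv: "convex_on Y g" and der: "(g has_derivative (\<lambda>z. D \<bullet> z)) (at y)"
    and y: "y \<in> Y" and y': "y' \<in> Y"
  shows "g y + D \<bullet> (y' - y) \<le> g y'"
proof -
  have "((\<lambda>s. y + s *\<^sub>R (y' - y)) has_derivative (\<lambda>s. s *\<^sub>R (y' - y))) (at 0)"
    by (auto intro!: derivative_eq_intros)
  then have "((\<lambda>s. g (y + s *\<^sub>R (y' - y))) has_derivative (\<lambda>s. D \<bullet> (s *\<^sub>R (y' - y)))) (at 0)"
    by (rule has_derivative_compose) (use der in simp)
  then have "((\<lambda>s. g (y + s *\<^sub>R (y' - y))) has_real_derivative D \<bullet> (y' - y)) (at 0)"
    by (simp add: has_field_derivative_def mult_commute_abs)
  then have "((\<lambda>s. (g (y + s *\<^sub>R (y' - y)) - g y) / s) \<longlongrightarrow> D \<bullet> (y' - y)) (at_right 0)"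
    unfolding DERIV_def by (auto intro: filterlim_mono at_le)
  moreover have "eventually (\<lambda>s. (g (y + s *\<^sub>R (y' - y)) - g y) / s \<le> g y' - g y) (at_right 0)"
    unfolding eventually_at_right_field
  proof (intro exI[of _ 1] conjI allI impI)
    fix s :: real assume s: "0 < s" "s < 1"
    have "g (y + s *\<^sub>R (y' - y)) \<le> (1 - s) * g y + s * g y'"
      using convex_onD[OF conv, of s y y'] s y y' by (simp add: algebra_simps)
    then show "(g (y + s *\<^sub>R (y' - y)) - g y) / s \<le> g y' - g y"
      using s by (simp add: field_simps)
  qed simp
  ultimately have "D \<bullet> (y' - y) \<le> g y' - g y"
    by (intro tendsto_upperbound[of _ _ "at_right 0"]) auto
  then show ?thesis by simp
qed

subsection \<open>The Beckmann potential\<close>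

text \<open>Leibniz' rule for gradient vectors. The general rule integrates bounded linear maps;
  passing from a vector to its inner-product functional is bounded linear and so commutes with the
  integral.\<close>

lemma has_derivative_integral_gradient:
  fixes h :: "'b::euclidean_space \<Rightarrow> real \<Rightarrow> real"
  assumes "open W"
    and der: "\<And>p r. p \<in> W \<Longrightarrow> r \<in> {0..1} \<Longrightarrow> ((\<lambda>p. h p r) has_derivative (\<lambda>z. D p r \<bullet> z)) (at p)"
    and int: "\<And>p. p \<in> W \<Longrightarrow> continuous_on {0..1} (h p)"
    and cont: "continuous_on (W \<times> {0..1}) (\<lambda>(p, r). D p r)"
    and "p \<in> W"
  shows "((\<lambda>p. integral {0..1} (h p)) has_derivative (\<lambda>z. integral {0..1} (D p) \<bullet> z)) (at p)"
proof -
  obtain e where "0 < e" and e: "ball p e \<subseteq> W"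
    using \<open>open W\<close> \<open>p \<in> W\<close> open_contains_ball by blast
  have D_cont: "continuous_on {0..1} (D p)"
    using continuous_on_compose2[OF cont, of "{0..1}" "\<lambda>r. (p, r)"] \<open>p \<in> W\<close>
      continuous_on_Pair[OF continuous_on_const continuous_on_id, of "{0..1}" p]
    by auto
  have "((\<lambda>p. integral (cbox 0 1) (h p)) has_derivative
      blinfun_apply (integral (cbox 0 1) (\<lambda>r. blinfun_inner_right (D p r)))) (at p within ball p e)"
  proof (rule leibniz_rule)
    show "((\<lambda>p. h p r) has_derivative blinfun_apply (blinfun_inner_right (D q r))) (at q within ball p e)"
      if "q \<in> ball p e" "r \<in> cbox 0 1" for q r
      using has_derivative_at_withinI[OF der[of q r]] that e by (auto simp: subset_iff)
    show "h q integrable_on cbox 0 1" if "q \<in> ball p e" for q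
      using integrable_continuous_real[OF int[of q]] that e by (auto simp: subset_iff)
    have "continuous_on (ball p e \<times> cbox 0 1) (\<lambda>(p, r). D p r)"
      by (rule continuous_on_subset[OF cont]) (use e in auto)
    then show "continuous_on (ball p e \<times> cbox 0 1) (\<lambda>(q, r). blinfun_inner_right (D q r))"
      unfolding split_beta by (intro continuous_intros)
  qed (use \<open>0 < e\<close> in auto)
  moreover have "integral (cbox 0 1) (\<lambda>r. blinfun_inner_right (D p r)) = blinfun_inner_right (integral {0..1} (D p))"
    using integral_linear[OF integrable_continuous_real[OF D_cont] bounded_linear_blinfun_inner_right]
    by (simp add: o_def)
  ultimately show ?thesis
    using at_within_open[of p "ball p e"] \<open>0 < e\<close> by simp
qed

lemma continuous_on_integral_gradient:
  fixes D :: "'b::topological_space \<Rightarrow> real \<Rightarrow> 'c::euclidean_space"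
  assumes "continuous_on (W \<times> {0..1}) (\<lambda>(p, r). D p r)"
  shows "continuous_on W (\<lambda>p. integral {0..1} (D p))"
  using integral_continuous_on_param[of W 0 1 D] assms by simp

text \<open>Moves the variable limit into the integrand, so that Leibniz' rule applies jointly in
  \<open>(y, x)\<close> and in a full neighbourhood of \<open>x = 0\<close>.\<close>

lemma sint0_rescale:
  assumes "continuous_on (closed_segment 0 x) h"
  shows "sint0 h x = x * integral {0..1} (\<lambda>r. h (x * r))"
proof -
  consider "x = 0" | "0 < x" | "x < 0" by linarith
  then show ?thesis
  proof cases
    case 2
    have im: "(\<lambda>r. r / x) ` {0..x} = {0..1}"
      using 2 image_divide_atLeastAtMost[of x 0 x] by simp
    have "(h has_integral integral {0..x} h) (cbox 0 x)"
      using assms 2 by (auto simp: closed_segment_eq_real_ivl intro!: integrable_integral integrable_continuous_real)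
    from has_integral_affinity[OF this, of x 0] 2 im
    have "((\<lambda>r. h (x * r)) has_integral integral {0..x} h / x) {0..1}" by simp
    from integral_unique[OF this] show ?thesis using 2 by (simp add: sint0_def)
  next
    case 3
    \<comment> \<open>Division by a negative \<open>x\<close> reverses the interval and scales the
      integral by \<open>1 / (- x)\<close>; multiplying back by \<open>x\<close> yields the minus
      sign in \<open>sint0\<close>.\<close>
    have "(\<lambda>r. r / x) ` {x..0} = {0..1}"
    proof (intro equalityI subsetI)
      fix z assume "z \<in> {0..1::real}"
      then have "x * z \<in> {x..0}" using 3 by (auto simp: mult_le_0_iff)
      then show "z \<in> (\<lambda>r. r / x) ` {x..0}" using 3 by (intro image_eqI[of _ _ "x * z"]) auto
    qed (use 3 in \<open>auto simp: divide_simps\<close>)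
    moreover have "(h has_integral integral {x..0} h) (cbox x 0)"
      using assms 3 by (auto simp: closed_segment_eq_real_ivl intro!: integrable_integral integrable_continuous_real)
    from has_integral_affinity[OF this, of x 0] 3
    have "((\<lambda>r. h (x * r)) has_integral integral {x..0} h / (- x)) ((\<lambda>r. r / x) ` {x..0})" by simp
    ultimately have "((\<lambda>r. h (x * r)) has_integral integral {x..0} h / (- x)) {0..1}" by simp
    from integral_unique[OF this] show ?thesis using 3 by (simp add: sint0_def)
  qed (simp add: sint0_def)
qed

text \<open>After rescaling, the potential is \<open>x\<close> times an integral over a fixed
  interval, so Leibniz' rule and the product rule give a continuous gradient on an open set that
  contains the boundary \<open>y = 0\<close>.\<close>

lemma sint0_C1:
  fixes t :: "real \<Rightarrow> real \<Rightarrow> real"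
  assumes "open U" and U: "{p. 0 \<le> fst p} \<subseteq> U"
    and der: "\<And>p. p \<in> U \<Longrightarrow> ((\<lambda>q. t (fst q) (snd q)) has_derivative (\<lambda>h. D p \<bullet> h)) (at p)"
    and D_cont: "continuous_on U D"
  shows "\<exists>W E. open W \<and> {p. 0 \<le> fst p} \<subseteq> W
    \<and> (\<forall>p\<in>W. ((\<lambda>q. sint0 (t (fst q)) (snd q)) has_derivative (\<lambda>h. E p \<bullet> h)) (at p))
    \<and> continuous_on W E"
proof -
  \<comment> \<open>Points whose whole segment down to second coordinate 0 stays in
    \<open>U\<close>, so that the rescaled integrand is defined; openness follows from compactness
    of \<open>[0,1]\<close> by the tube lemma.\<close>
  define W where "W = {p :: real \<times> real. \<forall>r\<in>{0..1}. (fst p, snd p * r) \<in> U}"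
  have inU: "(fst p, snd p * r) \<in> U" if "p \<in> W" "r \<in> {0..1}" for p r using that by (auto simp: W_def)
  have W0: "{p. 0 \<le> fst p} \<subseteq> W" using U unfolding W_def by force
  have "open W"
  proof (subst open_subopen, intro ballI)
    fix p assume "p \<in> W"
    define O' where "O' = (\<lambda>q :: (real \<times> real) \<times> real. (fst (fst q), snd (fst q) * snd q)) -` U"
    have "open O'" unfolding O'_def by (intro open_vimage \<open>open U\<close>) (intro continuous_intros)
    moreover have "{p} \<times> {0..1} \<subseteq> O'" using inU[OF \<open>p \<in> W\<close>] by (auto simp: O'_def)
    ultimately obtain X where X: "p \<in> X" "open X" "X \<times> {0..1} \<subseteq> O'"
      using Elementary_Topology.tube_lemma[of "{0..1::real}" O' p] by auto
    have "X \<subseteq> W" using X(3) unfolding W_def O'_def by force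
    then show "\<exists>T. open T \<and> p \<in> T \<and> T \<subseteq> W" using X by blast
  qed
  have t_cont: "continuous_on U (\<lambda>q. t (fst q) (snd q))"
    using der by (intro continuous_at_imp_continuous_on) (auto intro: has_derivative_continuous)
  define H where "H p = integral {0..1} (\<lambda>r. t (fst p) (snd p * r))" for p :: "real \<times> real"
  \<comment> \<open>The factor \<open>r\<close> in the second component is the inner derivative of
    \<open>snd p * r\<close>.\<close>
  define D' where "D' p r = (fst (D (fst p, snd p * r)), r * snd (D (fst p, snd p * r)))" for p :: "real \<times> real" and r
  have "continuous_on (W \<times> {0..1}) (\<lambda>q. D (fst (fst q), snd (fst q) * snd q))"
    by (rule continuous_on_compose2[OF D_cont]) (auto intro!: continuous_intros inU)
  then have D'_cont: "continuous_on (W \<times> {0..1}) (\<lambda>(p, r). D' p r)"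
    unfolding D'_def split_beta by (intro continuous_intros)
  have H_der: "(H has_derivative (\<lambda>z. integral {0..1} (D' p) \<bullet> z)) (at p)" if "p \<in> W" for p
    unfolding H_def
  proof (rule has_derivative_integral_gradient[OF \<open>open W\<close> _ _ D'_cont that])
    fix p r assume pr: "p \<in> W" "r \<in> {0..1::real}"
    have "((\<lambda>p. (fst p, snd p * r)) has_derivative (\<lambda>z. (fst z, snd z * r))) (at p)"
      by (auto intro!: derivative_eq_intros)
    from has_derivative_compose[OF this der[OF inU[OF pr]]]
    show "((\<lambda>p. t (fst p) (snd p * r)) has_derivative (\<lambda>z. D' p r \<bullet> z)) (at p)"
      by (simp add: D'_def inner_prod_def mult_ac)
  next
    fix p assume "p \<in> W"
    have "continuous_on {0..1} (\<lambda>r. (fst p, snd p * r))" by (intro continuous_intros)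
    moreover have "(\<lambda>r. (fst p, snd p * r)) ` {0..1} \<subseteq> U" using inU[OF \<open>p \<in> W\<close>] by blast
    ultimately show "continuous_on {0..1} (\<lambda>r. t (fst p) (snd p * r))"
      using continuous_on_compose2[OF t_cont] by fastforce
  qed
  have H_eq: "snd p * H p = sint0 (t (fst p)) (snd p)" if "p \<in> W" for p
    unfolding H_def
  proof (rule sint0_rescale[symmetric])
    have "(fst p, w) \<in> U" if w: "w \<in> closed_segment 0 (snd p)" for w
    proof -
      obtain r where "r \<in> {0..1}" "w = snd p * r" using w by (auto simp: in_segment)
      then show ?thesis using inU[OF \<open>p \<in> W\<close>] by blast
    qed
    moreover have "continuous_on (closed_segment 0 (snd p)) (\<lambda>w. (fst p, w))"
      by (intro continuous_intros)
    ultimately show "continuous_on (closed_segment 0 (snd p)) (t (fst p))"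
      using continuous_on_compose2[OF t_cont, of "closed_segment 0 (snd p)" "\<lambda>w. (fst p, w)"]
      by auto
  qed
  define E where "E p = snd p *\<^sub>R integral {0..1} (D' p) + (0, H p)" for p
  have "((\<lambda>q. sint0 (t (fst q)) (snd q)) has_derivative (\<lambda>h. E p \<bullet> h)) (at p)" if "p \<in> W" for p
  proof (rule has_derivative_transform_within_open[OF _ \<open>open W\<close> that H_eq])
    show "((\<lambda>q. snd q * H q) has_derivative (\<lambda>h. E p \<bullet> h)) (at p)"
      by (rule derivative_eq_intros H_der[OF that] refl)+
        (auto simp: E_def inner_prod_def algebra_simps)
  qed
  moreover have "continuous_on W H"
    using H_der by (intro continuous_at_imp_continuous_on) (auto intro: has_derivative_continuous)
  then have "continuous_on W E" unfolding E_def
    by (intro continuous_intros continuous_on_integral_gradient D'_cont)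
  ultimately show ?thesis using \<open>open W\<close> W0 by blast
qed

lemma fpot_C1:
  fixes t :: "'a::finite \<Rightarrow> real \<Rightarrow> real \<Rightarrow> real"
  assumes t_C1: "\<forall>a. \<exists>U D. open U \<and> {p. 0 \<le> fst p} \<subseteq> U
                 \<and> (\<forall>p\<in>U. ((\<lambda>q. t a (fst q) (snd q)) has_derivative (\<lambda>h. D p \<bullet> h)) (at p))
                 \<and> continuous_on U D"
  obtains W E where "open W" "{p. \<forall>a. 0 \<le> fst p $ a} \<subseteq> W"
    "\<forall>p\<in>W. ((\<lambda>q. fpot t (fst q) (snd q)) has_derivative (\<lambda>h. E p \<bullet> h)) (at p)"
    "continuous_on W E"
proof -
  define C1 where "C1 a W E \<longleftrightarrow> open W \<and> {p. 0 \<le> fst p} \<subseteq> W \<and>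
    (\<forall>p\<in>W. ((\<lambda>q. sint0 (t a (fst q)) (snd q)) has_derivative (\<lambda>h. E p \<bullet> h)) (at p)) \<and>
    continuous_on W E" for a W E
  have "\<exists>W E. C1 a W E" for a
  proof -
    obtain U D where "open U" "{p. 0 \<le> fst p} \<subseteq> U"
       "\<forall>p\<in>U. ((\<lambda>q. t a (fst q) (snd q)) has_derivative (\<lambda>h. D p \<bullet> h)) (at p)" "continuous_on U D"
      using t_C1 by blast
    then show ?thesis using sint0_C1[of U "t a" D] unfolding C1_def by simp
  qed
  then obtain W E where "\<And>a. C1 a (W a) (E a)" by metis
  then have W: "\<And>a. open (W a)" "\<And>a. {p. 0 \<le> fst p} \<subseteq> W a"
    and der: "\<And>a p. p \<in> W a \<Longrightarrow> ((\<lambda>q. sint0 (t a (fst q)) (snd q)) has_derivative (\<lambda>h. E a p \<bullet> h)) (at p)"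
    and E: "\<And>a. continuous_on (W a) (E a)"
    unfolding C1_def by simp_all
  define c where "c a p = (fst p $ a, snd p $ a)" for a :: 'a and p :: "(real^'a) \<times> (real^'a)"
  define W' where "W' = (\<Inter>a. c a -` W a)"
  \<comment> \<open>Each link's planar gradient is placed in its own coordinate of both
    blocks.\<close>
  define E' where "E' p = (\<Sum>a\<in>UNIV. (fst (E a (c a p)) *\<^sub>R (axis a 1 :: real^'a), snd (E a (c a p)) *\<^sub>R (axis a 1 :: real^'a)))" for p
  have c_cont: "continuous_on A (c a)" for A a unfolding c_def by (intro continuous_intros)
  have "open W'" unfolding W'_def by (intro open_INT ballI open_vimage W c_cont) auto
  moreover have "{p. \<forall>a. 0 \<le> fst p $ a} \<subseteq> W'"
    unfolding W'_def c_def
    by (auto intro!: subsetD[OF W(2)])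
  moreover have "((\<lambda>q. fpot t (fst q) (snd q)) has_derivative (\<lambda>h. E' p \<bullet> h)) (at p)" if "p \<in> W'" for p
  proof -
    have "((\<lambda>q. sint0 (t a (fst q $ a)) (snd q $ a)) has_derivative (\<lambda>h. E a (c a p) \<bullet> c a h)) (at p)" for a
    proof -
      have "(c a has_derivative c a) (at p)" unfolding c_def
        by (intro bounded_linear_imp_has_derivative bounded_linear_Pair
            bounded_linear_compose[OF bounded_linear_vec_nth bounded_linear_fst]
            bounded_linear_compose[OF bounded_linear_vec_nth bounded_linear_snd])
      moreover have "c a p \<in> W a" using that by (auto simp: W'_def)
      ultimately have "((\<lambda>x. sint0 (t a (fst (c a x))) (snd (c a x))) has_derivative
          (\<lambda>h. E a (c a p) \<bullet> c a h)) (at p)"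
        by (intro has_derivative_compose[OF _ der])
      then show ?thesis by (simp add: c_def)
    qed
    then have "((\<lambda>q. \<Sum>a\<in>UNIV. sint0 (t a (fst q $ a)) (snd q $ a)) has_derivative
        (\<lambda>h. \<Sum>a\<in>UNIV. E a (c a p) \<bullet> c a h)) (at p)"
      by (intro has_derivative_sum)
    then show ?thesis unfolding fpot_def
      by (rule has_derivative_eq_rhs)
        (simp add: E'_def inner_sum_left inner_prod_def c_def inner_axis' fst_sum snd_sum sum.distrib)
  qed
  moreover have "continuous_on W' E'"
  proof -
    have "continuous_on W' (\<lambda>p. E a (c a p))" for a
      by (rule continuous_on_compose2[OF E c_cont]) (auto simp: W'_def)
    then show ?thesis unfolding E'_def
      by (intro continuous_on_sum continuous_on_Pair continuous_on_scaleR continuous_on_const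
          continuous_on_fst continuous_on_snd)
  qed
  ultimately show ?thesis by (intro that[of W' E'] ballI)
qed

section \<open>Strict convexity and uniqueness of the lower-level solution\<close>

text \<open>By the mean value theorem, the increments over the two halves of the interval are values
  of \<open>h\<close> times equal lengths, and the value from the right half is strictly
  larger.\<close>

lemma sint0_midpoint_less:
  fixes h :: "real \<Rightarrow> real"
  assumes mono: "strict_mono h" and cont: "continuous_on UNIV h"
    and "0 \<le> x" "0 \<le> y" "x \<noteq> y"
  shows "2 * sint0 h ((x + y) / 2) < sint0 h x + sint0 h y"
proof -
  have less: "2 * sint0 h ((x + y) / 2) < sint0 h x + sint0 h y" if xy: "0 \<le> x" "x < y" for x y
  proof -
    have der: "((\<lambda>x. integral {0..x} h) has_derivative (\<lambda>z. h w * z)) (at w within {a..b})"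
      if "0 \<le> a" "b \<le> y" "a \<le> w" "w \<le> b" for a b w
    proof -
      have "((\<lambda>x. integral {0..x} h) has_real_derivative h w) (at w within {0..y})"
        using that continuous_on_subset[OF cont] by (intro integral_has_real_derivative) auto
      then show ?thesis unfolding has_field_derivative_def
        by (rule has_derivative_subset) (use that in auto)
    qed
    define m where "m = (x + y) / 2"
    have m: "x < m" "m < y" "m - x = y - m" using xy by (auto simp: m_def field_simps)
    obtain w1 where w1: "w1 \<in> {x<..<m}" "integral {0..m} h - integral {0..x} h = h w1 * (m - x)"
      using mvt_simple[OF m(1) der[of x m]] xy m by force
    obtain w2 where w2: "w2 \<in> {m<..<y}" "integral {0..y} h - integral {0..m} h = h w2 * (y - m)"
      using mvt_simple[OF m(2) der[of m y]] xy m by force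
    have "h w1 < h w2" using w1 w2 strict_monoD[OF mono] by auto
    then have "h w1 * (m - x) < h w2 * (y - m)"
      unfolding m(3) using m(2) by (intro mult_strict_right_mono) auto
    then have "2 * integral {0..m} h < integral {0..x} h + integral {0..y} h"
      using w1(2) w2(2) by linarith
    then show ?thesis using xy m unfolding m_def[symmetric] sint0_def by simp
  qed
  show ?thesis
    using less[of x y] less[of y x] assms(3-5) by (cases "x < y") (auto simp: add.commute)
qed

text \<open>If \<open>v'\<close> were no worse than the minimizer \<open>v\<close>, their midpoint
  would be strictly better than both: coordinates where they agree contribute equally, and they
  differ in at least one.\<close>

lemma fpot_minimizer_unique:
  fixes t :: "'a::finite \<Rightarrow> real \<Rightarrow> real \<Rightarrow> real"
  assumes mono: "\<And>a. strict_mono (t a (y $ a))" and cont: "\<And>a. continuous_on UNIV (t a (y $ a))"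
    and "convex V" and nonneg: "\<And>v a. v \<in> V \<Longrightarrow> 0 \<le> v $ a"
    and v: "v \<in> V" "\<And>w. w \<in> V \<Longrightarrow> fpot t y v \<le> fpot t y w"
    and v': "v' \<in> V" "v' \<noteq> v"
  shows "fpot t y v < fpot t y v'"
proof (rule ccontr)
  assume "\<not> ?thesis"
  then have le: "fpot t y v' \<le> fpot t y v" by simp
  define w where "w = (1 / 2) *\<^sub>R v + (1 / 2) *\<^sub>R v'"
  have w: "w \<in> V" unfolding w_def using \<open>convex V\<close> v v' by (intro convexD) auto
  have wa: "w $ a = (v $ a + v' $ a) / 2" for a by (simp add: w_def)
  obtain a where a: "v $ a \<noteq> v' $ a" using v'(2) by (metis vec_eq_iff)
  have "(\<Sum>a\<in>UNIV. 2 * sint0 (t a (y $ a)) (w $ a))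
      < (\<Sum>a\<in>UNIV. sint0 (t a (y $ a)) (v $ a) + sint0 (t a (y $ a)) (v' $ a))"
  proof (rule sum_strict_mono_ex1)
    have *: "2 * sint0 (t b (y $ b)) (w $ b) < sint0 (t b (y $ b)) (v $ b) + sint0 (t b (y $ b)) (v' $ b)"
      if "v $ b \<noteq> v' $ b" for b
      unfolding wa by (rule sint0_midpoint_less) (use mono cont nonneg v v' that in auto)
    then show "\<exists>a\<in>UNIV. 2 * sint0 (t a (y $ a)) (w $ a) < sint0 (t a (y $ a)) (v $ a) + sint0 (t a (y $ a)) (v' $ a)"
      using a by blast
    show "\<forall>b\<in>UNIV. 2 * sint0 (t b (y $ b)) (w $ b) \<le> sint0 (t b (y $ b)) (v $ b) + sint0 (t b (y $ b)) (v' $ b)"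
    proof
      fix b
      show "2 * sint0 (t b (y $ b)) (w $ b) \<le> sint0 (t b (y $ b)) (v $ b) + sint0 (t b (y $ b)) (v' $ b)"
        using *[of b] by (cases "v $ b = v' $ b") (auto simp: wa)
    qed
  qed simp
  then have "2 * fpot t y w < fpot t y v + fpot t y v'"
    unfolding fpot_def by (simp add: sum.distrib sum_distrib_left)
  with le v(2)[OF w] show False by simp
qed

lemma convex_on_fpot:
  fixes t :: "'a::finite \<Rightarrow> real \<Rightarrow> real \<Rightarrow> real"
  assumes conv: "\<And>a. convex_on {p. 0 \<le> fst p \<and> 0 \<le> snd p} (\<lambda>p. sint0 (t a (fst p)) (snd p))"
    and "convex Y" "convex V" and Y: "\<And>y a. y \<in> Y \<Longrightarrow> 0 \<le> y $ a" and V: "\<And>v a. v \<in> V \<Longrightarrow> 0 \<le> v $ a"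
  shows "convex_on (Y \<times> V) (\<lambda>p. fpot t (fst p) (snd p))"
proof (rule convex_onI)
  fix s :: real and p q :: "(real^'a) \<times> (real^'a)"
  assume s: "0 < s" "s < 1" and pq: "p \<in> Y \<times> V" "q \<in> Y \<times> V"
  define r where "r = (1 - s) *\<^sub>R p + s *\<^sub>R q"
  have "sint0 (t a (fst r $ a)) (snd r $ a) \<le>
    (1 - s) * sint0 (t a (fst p $ a)) (snd p $ a) + s * sint0 (t a (fst q $ a)) (snd q $ a)" for a
    using convex_onD[OF conv, of s "(fst p $ a, snd p $ a)" "(fst q $ a, snd q $ a)"] s pq Y V
    by (auto simp: r_def)
  then have "fpot t (fst r) (snd r) \<le> (\<Sum>a\<in>UNIV. (1 - s) * sint0 (t a (fst p $ a)) (snd p $ a)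
      + s * sint0 (t a (fst q $ a)) (snd q $ a))"
    unfolding fpot_def by (rule sum_mono)
  also have "\<dots> = (1 - s) * fpot t (fst p) (snd p) + s * fpot t (fst q) (snd q)"
    unfolding fpot_def by (simp add: sum.distrib sum_distrib_left)
  finally show "fpot t (fst ((1 - s) *\<^sub>R p + s *\<^sub>R q)) (snd ((1 - s) *\<^sub>R p + s *\<^sub>R q))
      \<le> (1 - s) * fpot t (fst p) (snd p) + s * fpot t (fst q) (snd q)"
    by (simp add: r_def)
qed (intro convex_Times assms)

lemma Fobj_differentiable:
  fixes t :: "'a::finite \<Rightarrow> real \<Rightarrow> real \<Rightarrow> real"
  assumes t: "\<And>a. (\<lambda>q. t a (fst q) (snd q)) differentiable (at (y $ a, v $ a))"
    and G: "\<And>a. G a differentiable (at (y $ a))"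
  shows "(\<lambda>p. Fobj t G eta (fst p) (snd p)) differentiable (at (y, v))"
proof -
  have fst_a: "(\<lambda>p. fst p $ a) differentiable (at (y, v))" for a
    by (intro bounded_linear_imp_differentiable bounded_linear_compose[OF bounded_linear_vec_nth bounded_linear_fst])
  have snd_a: "(\<lambda>p. snd p $ a) differentiable (at (y, v))" for a
    by (intro bounded_linear_imp_differentiable bounded_linear_compose[OF bounded_linear_vec_nth bounded_linear_snd])
  have pair: "(\<lambda>p. (fst p $ a, snd p $ a)) differentiable (at (y, v))" for a
    by (intro bounded_linear_imp_differentiable bounded_linear_Pair
        bounded_linear_compose[OF bounded_linear_vec_nth bounded_linear_fst]
        bounded_linear_compose[OF bounded_linear_vec_nth bounded_linear_snd])
  have t_a: "(\<lambda>p. t a (fst p $ a) (snd p $ a)) differentiable (at (y, v))" for a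
    using differentiable_compose[of "\<lambda>q. t a (fst q) (snd q)" "\<lambda>p. (fst p $ a, snd p $ a)" "(y, v)" UNIV]
      t[of a] pair[of a] by simp
  have "(\<lambda>p. t a (fst p $ a) (snd p $ a) * snd p $ a) differentiable (at (y, v))" for a
    by (rule differentiable_mult[OF t_a snd_a])
  moreover have "(\<lambda>p. G a (fst p $ a)) differentiable (at (y, v))" for a
    using differentiable_compose[of "G a" "\<lambda>p. fst p $ a" "(y, v)" UNIV] G[of a] fst_a[of a] by simp
  ultimately show ?thesis unfolding Fobj_def
    by (intro differentiable_add differentiable_sum
        differentiable_mult[OF differentiable_const differentiable_sum]) auto
qed

subsection \<open>Feasible sets\<close>

lemma convex_Vset: "convex (Vset Delta Lambda d)"
proof (rule convexI)
  fix x y and p q :: real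
  assume xy: "x \<in> Vset Delta Lambda d" "y \<in> Vset Delta Lambda d" and pq: "0 \<le> p" "0 \<le> q" "p + q = 1"
  obtain h k :: "real^'b" where h: "\<forall>r. 0 \<le> h$r" "\<forall>w. (\<Sum>r\<in>UNIV. Lambda w r * h$r) = d w" "\<forall>a. x$a = (\<Sum>r\<in>UNIV. Delta a r * h$r)"
    and k: "\<forall>r. 0 \<le> k$r" "\<forall>w. (\<Sum>r\<in>UNIV. Lambda w r * k$r) = d w" "\<forall>a. y$a = (\<Sum>r\<in>UNIV. Delta a r * k$r)"
    using xy unfolding Vset_def by blast
  have lin: "(\<Sum>r\<in>UNIV. c r * (p *\<^sub>R h + q *\<^sub>R k)$r) = p * (\<Sum>r\<in>UNIV. c r * h$r) + q * (\<Sum>r\<in>UNIV. c r * k$r)" for c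
    by (simp add: sum_distrib_left sum.distrib[symmetric] algebra_simps)
  show "p *\<^sub>R x + q *\<^sub>R y \<in> Vset Delta Lambda d"
    unfolding Vset_def
  proof (intro CollectI exI[of _ "p *\<^sub>R h + q *\<^sub>R k"] conjI allI)
    show "(\<Sum>r\<in>UNIV. Lambda w r * (p *\<^sub>R h + q *\<^sub>R k) $ r) = d w" for w
      unfolding lin using h k pq by (simp add: distrib_right[symmetric])
    show "(p *\<^sub>R x + q *\<^sub>R y) $ a = (\<Sum>r\<in>UNIV. Delta a r * (p *\<^sub>R h + q *\<^sub>R k) $ r)" for a
      unfolding lin using h k by simp
  qed (use h k pq in auto)
qed

lemma Vset_nonneg:
  assumes "\<And>a r. 0 \<le> Delta a r" "v \<in> Vset Delta Lambda d"
  shows "0 \<le> v $ a"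
  using assms unfolding Vset_def by (auto intro!: sum_nonneg mult_nonneg_nonneg)

text \<open>Link flows are the linear image of the route flow polytope. That polytope is bounded
  because each route serves some OD pair, whose demand caps the route flow.\<close>

lemma compact_Vset:
  fixes Delta :: "'a::finite \<Rightarrow> 'r::finite \<Rightarrow> real" and Lambda :: "'w::finite \<Rightarrow> 'r \<Rightarrow> real"
  assumes Lambda_nonneg: "\<And>w r. 0 \<le> Lambda w r" and route: "\<And>r. \<exists>w. Lambda w r = 1"
  shows "compact (Vset Delta Lambda d)"
proof -
  define H where "H = {h::real^'r. (\<forall>r. 0 \<le> h$r) \<and> (\<forall>w. (\<Sum>r\<in>UNIV. Lambda w r * h$r) = d w)}"
  define B where "B = (\<Sum>w\<in>UNIV. \<bar>d w\<bar>)"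
  have "closed H" unfolding H_def
    by (intro closed_Collect_conj closed_Collect_all closed_Collect_le closed_Collect_eq continuous_intros)
  moreover have "h $ r \<le> B" if "h \<in> H" for h r
  proof -
    obtain w where w: "Lambda w r = 1" using route by blast
    have "h $ r = Lambda w r * h $ r" using w by simp
    also have "\<dots> \<le> (\<Sum>r\<in>UNIV. Lambda w r * h $ r)"
      using that Lambda_nonneg by (intro member_le_sum) (auto simp: H_def)
    also have "\<dots> = d w" using that by (auto simp: H_def)
    also have "\<dots> \<le> \<bar>d w\<bar>" by simp
    also have "\<dots> \<le> B" unfolding B_def by (intro member_le_sum) auto
    finally show ?thesis .
  qed
  then have "H \<subseteq> cbox 0 (\<chi> r. B)" by (auto simp: mem_box_cart H_def)
  then have "bounded H" using bounded_cbox bounded_subset by blast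
  ultimately have "compact H" by (simp add: compact_eq_bounded_closed)
  moreover have "continuous_on H (\<lambda>h. \<chi> a. \<Sum>r\<in>UNIV. Delta a r * h$r)"
    by (intro continuous_intros)
  ultimately have "compact ((\<lambda>h. \<chi> a. \<Sum>r\<in>UNIV. Delta a r * h$r) ` H)"
    by (rule compact_continuous_image[rotated])
  moreover have "(\<lambda>h. \<chi> a. \<Sum>r\<in>UNIV. Delta a r * h$r) ` H = Vset Delta Lambda d"
    unfolding Vset_def H_def by (auto simp: vec_eq_iff image_iff)
  ultimately show ?thesis by simp
qed

text \<open>All demand of an OD pair is sent along one chosen route; as a route serves a single
  pair, this leaves the balance of the other pairs intact.\<close>

lemma Vset_nonempty:
  fixes Delta :: "'a::finite \<Rightarrow> 'r::finite \<Rightarrow> real" and Lambda :: "'w::finite \<Rightarrow> 'r \<Rightarrow> real"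
  assumes Lambda01: "\<And>w r. Lambda w r = 0 \<or> Lambda w r = 1"
    and route_od: "\<And>r. \<exists>!w. Lambda w r = 1" and od_route: "\<And>w. \<exists>r. Lambda w r = 1"
    and "\<And>w. 0 \<le> d w"
  shows "Vset Delta Lambda d \<noteq> {}"
proof -
  obtain \<rho> where \<rho>: "\<And>w. Lambda w (\<rho> w) = 1" using od_route by metis
  have L: "Lambda w (\<rho> w') = (if w' = w then 1 else 0)" for w w'
    using \<rho> Lambda01 route_od by metis
  define h :: "real^'r" where "h = (\<chi> r. \<Sum>w\<in>UNIV. if \<rho> w = r then d w else 0)"
  have "(\<Sum>r\<in>UNIV. Lambda w r * h $ r) = d w" for w
  proof -
    have "(\<Sum>r\<in>UNIV. Lambda w r * h $ r) = (\<Sum>r\<in>UNIV. \<Sum>w'\<in>UNIV. if \<rho> w' = r then Lambda w r * d w' else 0)"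
      unfolding h_def by (simp add: sum_distrib_left if_distrib cong: if_cong)
    also have "\<dots> = (\<Sum>w'\<in>UNIV. Lambda w (\<rho> w') * d w')"
      by (subst sum.swap) simp
    also have "\<dots> = d w" unfolding L by (simp add: if_distrib[of "\<lambda>x. x * _"] cong: if_cong)
    finally show ?thesis .
  qed
  moreover have "0 \<le> h $ r" for r unfolding h_def using assms(4) by (auto intro!: sum_nonneg)
  ultimately have "(\<chi> a. \<Sum>r\<in>UNIV. Delta a r * h $ r) \<in> Vset Delta Lambda d"
    unfolding Vset_def by auto
  then show ?thesis by blast
qed

lemma Yset_eq_cbox: "Yset u = cbox 0 (\<chi> a. u a)"
  by (auto simp: Yset_def mem_box_cart)

text \<open>The cardinality bound becomes a finite union over admissible supports \<open>S\<close>,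
  and vanishing off a fixed \<open>S\<close> is a closed condition.\<close>

lemma closed_Upsilon: "closed (Upsilon u tau)"
proof -
  have "Upsilon u tau = (\<Union>S\<in>{S. card S \<le> tau}. Yset u \<inter> {y. \<forall>a\<in>-S. y $ a \<le> 0})"
  proof (intro equalityI subsetI)
    fix y assume "y \<in> Upsilon u tau"
    then show "y \<in> (\<Union>S\<in>{S. card S \<le> tau}. Yset u \<inter> {y. \<forall>a\<in>-S. y $ a \<le> 0})"
      unfolding Upsilon_def by (intro UN_I[of "{a. 0 < y $ a}"]) auto
  next
    fix y assume "y \<in> (\<Union>S\<in>{S. card S \<le> tau}. Yset u \<inter> {y. \<forall>a\<in>-S. y $ a \<le> 0})"
    then obtain S where S: "card S \<le> tau" "y \<in> Yset u" "\<forall>a\<in>-S. y $ a \<le> 0" by blast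
    then have "{a. 0 < y $ a} \<subseteq> S" by force
    then have "card {a. 0 < y $ a} \<le> card S" by (intro card_mono) auto
    with S show "y \<in> Upsilon u tau" by (simp add: Upsilon_def)
  qed
  moreover have "closed (Yset u \<inter> {y. \<forall>a\<in>-S. y $ a \<le> 0})" for S
    unfolding Yset_eq_cbox Ball_def
    by (intro closed_Int closed_cbox closed_Collect_all closed_Collect_imp open_Collect_const
        closed_Collect_le continuous_intros)
  ultimately show ?thesis by (simp only:) (intro closed_UN ballI finite)
qed

section \<open>The network problem as an instance of the abstract setting\<close>

theorem theorem4p2:
  fixes Delta :: "'a::finite \<Rightarrow> 'r::finite \<Rightarrow> real"
    and Lambda :: "'w::finite \<Rightarrow> 'r \<Rightarrow> real"
    and d :: "'w \<Rightarrow> real"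
    and u :: "'a \<Rightarrow> real"
    and tau :: nat
    and t :: "'a \<Rightarrow> real \<Rightarrow> real \<Rightarrow> real"
    and G :: "'a \<Rightarrow> real \<Rightarrow> real"
    and eta thl thu rho0 sig eps :: real
    and y0 :: "real^'a"
  assumes Delta01: "\<forall>a r. Delta a r = 0 \<or> Delta a r = 1"
    and Lambda01: "\<forall>w r. Lambda w r = 0 \<or> Lambda w r = 1"
    and route_od: "\<forall>r. \<exists>!w. Lambda w r = 1"
    and od_route: "\<forall>w. \<exists>r. Lambda w r = 1"
    and d_pos: "\<forall>w. 0 < d w"
    and u_nonneg: "\<forall>a. 0 \<le> u a"
    and tau_bounds: "1 \<le> tau" "tau \<le> CARD('a)"
    and t_C1: "\<forall>a. \<exists>U D. open U \<and> {p. 0 \<le> fst p} \<subseteq> U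
                 \<and> (\<forall>p\<in>U. ((\<lambda>q. t a (fst q) (snd q)) has_derivative (\<lambda>h. D p \<bullet> h)) (at p))
                 \<and> continuous_on U D"
    and t_mono: "\<forall>a y. 0 \<le> y \<longrightarrow> strict_mono (t a y)"
    and G_C1: "\<forall>a. \<exists>U G'. open U \<and> {0..} \<subseteq> U
                 \<and> (\<forall>x\<in>U. (G a has_real_derivative G' x) (at x)) \<and> continuous_on U G'"
    and G_nonneg: "\<forall>a x. 0 \<le> x \<longrightarrow> 0 \<le> G a x"
    and G_mono: "\<forall>a. strict_mono_on {0..} (G a)"
    and G_convex: "\<forall>a. convex_on {0..} (G a)"
    and int_convex: "\<forall>a. convex_on {p. 0 \<le> fst p \<and> 0 \<le> snd p}
                          (\<lambda>p. sint0 (t a (fst p)) (snd p))"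
    and tv_convex: "\<forall>a. convex_on {p. 0 \<le> fst p \<and> 0 \<le> snd p}
                          (\<lambda>p. t a (fst p) (snd p) * snd p)"
    and eta_pos: "0 < eta"
    and theta: "0 < thl" "thl < thu"
    and rho0_pos: "0 < rho0"
    and sigma_gt: "1 < sig"
    and y0_in: "y0 \<in> Upsilon u tau"
    and eps_pos: "0 < eps"
  shows "\<exists>eb1>0. \<forall>e1. 0 < e1 \<and> e1 \<le> eb1 \<longrightarrow>
     (\<forall>ys vs rhos betas.
        pdc_run (Fobj t G eta) (fpot t) (gval (Vset Delta Lambda d) (fpot t)) (tvec t)
                (Vset Delta Lambda d) (Upsilon u tau)
                e1 (eps / (2 * sqrt 2 * thu)) eps thl thu rho0 sig y0 ys vs rhos betas
        \<longrightarrow> (\<exists>K. pdc_stop (fpot t) (gval (Vset Delta Lambda d) (fpot t))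
                          e1 (eps / (2 * sqrt 2 * thu)) eps ys vs K
               \<and> (\<forall>i<K. \<not> pdc_stop (fpot t) (gval (Vset Delta Lambda d) (fpot t))
                          e1 (eps / (2 * sqrt 2 * thu)) eps ys vs i)
               \<and> approx_kkt (Fobj t G eta)
                    (\<lambda>y v. fpot t y v - gval (Vset Delta Lambda d) (fpot t) y)
                    (Upsilon u tau) (Vset Delta Lambda d) eps (ys (Suc K)) (vs (Suc K))))"
proof -
  define V where "V = Vset Delta Lambda d"
  define g where "g = gval V (fpot t)"
  have V_nonneg: "0 \<le> v $ a" if "v \<in> V" for v a
  proof (rule Vset_nonneg)
    show "0 \<le> Delta a r" for a r using Delta01 by (metis zero_le_one order_refl)
  qed (use that in \<open>simp add: V_def\<close>)
  have V_compact: "compact V" unfolding V_def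
  proof (rule compact_Vset)
    show "0 \<le> Lambda w r" for w r using Lambda01 by (metis zero_le_one order_refl)
    show "\<exists>w. Lambda w r = 1" for r using route_od by blast
  qed
  have V_ne: "V \<noteq> {}" unfolding V_def
    using Lambda01 route_od od_route d_pos by (intro Vset_nonempty) (auto intro: less_imp_le)
  have V_convex: "convex V" unfolding V_def by (rule convex_Vset)
  have Y_nonneg: "0 \<le> y $ a" if "y \<in> Yset u" for y a using that by (simp add: Yset_def)
  have Y_compact: "compact (Yset u)" and Y_convex: "convex (Yset u)"
    unfolding Yset_eq_cbox by (rule compact_cbox convex_box)+
  have t_diff: "(\<lambda>q. t a (fst q) (snd q)) differentiable (at (x, w))" if x: "0 \<le> x" for a x w
  proof -
    obtain U D where "{p. 0 \<le> fst p} \<subseteq> U"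
      and D: "\<forall>p\<in>U. ((\<lambda>q. t a (fst q) (snd q)) has_derivative (\<lambda>h. D p \<bullet> h)) (at p)"
      using t_C1 by blast
    then have "(x, w) \<in> U" using x by auto
    then show ?thesis using D unfolding differentiable_def by blast
  qed
  have t_cont: "continuous_on UNIV (t a x)" if "0 \<le> x" for a x
  proof (rule continuous_at_imp_continuous_on, intro ballI)
    fix w :: real
    have "isCont (\<lambda>w. (x, w)) w" by (intro continuous_intros)
    moreover have "isCont (\<lambda>q. t a (fst q) (snd q)) (x, w)"
      by (rule differentiable_imp_continuous_within[OF t_diff[OF that]])
    ultimately have "isCont (\<lambda>w. t a (fst (x, w)) (snd (x, w))) w" by (rule isCont_o2)
    then show "isCont (t a x) w" by simp
  qed
  have G_diff: "G a differentiable (at x)" if "0 \<le> x" for a x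
  proof -
    obtain U G' where "{0..} \<subseteq> U" and G': "\<forall>x\<in>U. (G a has_real_derivative G' x) (at x)"
      using G_C1 by blast
    then have "x \<in> U" using that by auto
    then show ?thesis using G' real_differentiable_def by blast
  qed
  \<comment> \<open>\<open>\<Omega>\<close> is open and contains every nonnegative design with every
    flow, so gradients are two-sided even where some \<open>y $ a\<close> is 0.\<close>
  obtain \<Omega> E where \<Omega>: "open \<Omega>" "{p. \<forall>a. 0 \<le> fst p $ a} \<subseteq> \<Omega>"
    and f_der': "\<forall>p\<in>\<Omega>. ((\<lambda>q. fpot t (fst q) (snd q)) has_derivative (\<lambda>h. E p \<bullet> h)) (at p)"
    and E_cont: "continuous_on \<Omega> E"
    by (rule fpot_C1[OF t_C1])
  note f_der = bspec[OF f_der']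
  have sub: "Yset u \<times> V \<subseteq> \<Omega>" using \<Omega>(2) Y_nonneg by auto
  have f_cont: "continuous_on \<Omega> (\<lambda>q. fpot t (fst q) (snd q))"
    using f_der by (intro continuous_at_imp_continuous_on) (auto intro: has_derivative_continuous)
  have "\<exists>v\<in>V. \<forall>w\<in>V. fpot t y v \<le> fpot t y w" if "y \<in> Yset u" for y
  proof (rule continuous_attains_inf[OF V_compact V_ne])
    have "continuous_on V (\<lambda>v. (y, v))" by (intro continuous_intros)
    moreover have "(\<lambda>v. (y, v)) ` V \<subseteq> \<Omega>" using sub that by auto
    ultimately show "continuous_on V (fpot t y)"
      using continuous_on_compose2[OF f_cont, of V "\<lambda>v. (y, v)"] by simp
  qed
  then obtain m where m: "\<And>y. y \<in> Yset u \<Longrightarrow> m y \<in> V"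
    and min: "\<And>y v. y \<in> Yset u \<Longrightarrow> v \<in> V \<Longrightarrow> fpot t y (m y) \<le> fpot t y v"
    by metis
  have uniq: "fpot t y (m y) < fpot t y v" if "y \<in> Yset u" "v \<in> V" "v \<noteq> m y" for y v
    by (rule fpot_minimizer_unique[OF _ _ V_convex V_nonneg m[OF that(1)] min[OF that(1)] that(2,3)])
      (use t_mono t_cont Y_nonneg[OF that(1)] in auto)
  have g_eq: "g y = fpot t y (m y)" if "y \<in> Yset u" for y
    unfolding g_def using m min that by (intro gval_eq) auto
  \<comment> \<open>This identifies the gradient of \<open>g\<close> as the y-part of the gradient
    of the potential at the equilibrium flow; its continuity then reduces to that of
    \<open>E\<close> and \<open>m\<close>.\<close>
  have g_der: "(g has_derivative (\<lambda>z. fst (E (y, m y)) \<bullet> z)) (at y)" if "y \<in> Yset u" for y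
    unfolding g_def
    by (rule has_derivative_gval[OF \<Omega>(1) _ V_compact f_der E_cont m[OF that] uniq[OF that]]) (use sub that in auto)
  have grad_g: "grad g y = fst (E (y, m y))" if "y \<in> Yset u" for y
    by (rule grad_eqI[OF g_der[OF that]])
  have "continuous_on (Yset u) m"
    by (rule continuous_on_argmin[OF \<Omega>(1) sub V_compact f_cont m uniq])
  then have "continuous_on (Yset u) (\<lambda>y. (y, m y))" by (intro continuous_intros)
  moreover have "(\<lambda>y. (y, m y)) ` Yset u \<subseteq> \<Omega>" using sub m by auto
  ultimately have "continuous_on (Yset u) (\<lambda>y. fst (E (y, m y)))"
    by (intro continuous_on_fst continuous_on_compose2[OF E_cont])
  then have grad_cont: "continuous_on (Yset u) (grad g)"
    using grad_g by (simp cong: continuous_on_cong)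
  have f_convex: "convex_on (Yset u \<times> V) (\<lambda>p. fpot t (fst p) (snd p))"
    using int_convex Y_convex V_convex Y_nonneg V_nonneg by (intro convex_on_fpot) auto
  have g_convex: "convex_on (Yset u) g"
    unfolding g_def by (rule convex_on_gval[OF f_convex Y_convex V_convex, where m = m]) (use m min in auto)
  interpret pdc_setting "Fobj t G eta" "fpot t" g V "Yset u" "Upsilon u tau"
  proof
    show "compact V" by (rule V_compact)
    show "compact (Yset u)" by (rule Y_compact)
    show "closed (Upsilon u tau)" by (rule closed_Upsilon)
    show "Upsilon u tau \<subseteq> Yset u" by (auto simp: Upsilon_def)
    show "continuous_on (Yset u) (grad g)" by (rule grad_cont)
    fix y assume y: "y \<in> Yset u"
    show "g differentiable (at y)" using g_der[OF y] unfolding differentiable_def by blast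
    show "\<exists>v\<in>V. g y = fpot t y v" using g_eq m y by blast
    show "g y + grad g y \<bullet> (y' - y) \<le> g y'" if "y' \<in> Yset u" for y'
      unfolding grad_g[OF y] by (rule convex_on_above_tangent[OF g_convex g_der[OF y] y that])
    fix v assume v: "v \<in> V"
    show "g y \<le> fpot t y v" unfolding g_eq[OF y] by (rule min[OF y v])
    show "(\<lambda>p. fpot t (fst p) (snd p)) differentiable (at (y, v))"
      using f_der[of "(y, v)"] sub y v unfolding differentiable_def by blast
    show "(\<lambda>p. Fobj t G eta (fst p) (snd p)) differentiable (at (y, v))"
      by (intro Fobj_differentiable t_diff G_diff Y_nonneg[OF y])
  qed
  show ?thesis
    unfolding V_def[symmetric] g_def[symmetric]
    by (rule pdc_terminates[OF theta rho0_pos sigma_gt y0_in eps_pos])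
qed

end
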